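(* Let $c=a+ib$ with $a,b\in\mathbb R$, and let $L=\partial_t-c\,\partial_x$ on $\mathbb T^2$. Let $k_1,k_2\in\mathbb R$, and let $f\in H_{\mathrm{mix}}^{(k_1,k_2)}(\mathbb T^2)$ satisfy $\widehat f(0,0)=0$. Then the following hold. (i) If $b\ne0$, there exists a unique distributional solution $u$ of $Lu=f$ satisfying $\widehat u(0,0)=0$. Moreover, for every $\theta\in[0,1]$, $u\in H_{\mathrm{mix}}^{(k_1+\theta,\,k_2+1-\theta)}(\mathbb T^2)$. (ii) If $b=0$ and $a\in\mathbb R\setminus\mathbb Q$ has finite irrationality measure $\mu(a)$, there exists a unique distributional solution $u$ of $Lu=f$ satisfying $\widehat u(0,0)=0$. Moreover, for every $r>\mu(a)$ and every $\theta\in[-r,1]$, $u\in H_{\mathrm{mix}}^{(k_1+\theta,\,k_2+1-r-\theta)}(\mathbb T^2)$.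
   Context: $\mathbb T=\mathbb R/2\pi\mathbb Z$, with variables $(t,x)\in\mathbb T^2$ and dual frequencies $(\tau,\xi)\in\mathbb Z^2$. $\mathcal D'(\mathbb T^2)$ is the space of distributions on $\mathbb T^2$. Fourier coefficients are $\widehat f(\tau,\xi)=\frac1{(2\pi)^2}\int_{\mathbb T^2}f(t,x)e^{-i(t\tau+x\xi)}\,dt\,dx$ (by duality for distributions). $\langle w\rangle=(1+|w|^2)^{1/2}$. For $s_1,s_2\in\mathbb R$, $H_{\mathrm{mix}}^{(s_1,s_2)}(\mathbb T^2)$ is the space of $f\in\mathcal D'(\mathbb T^2)$ with $\sum_{(\tau,\xi)\in\mathbb Z^2}\langle\tau\rangle^{2s_1}\langle\xi\rangle^{2s_2}|\widehat f(\tau,\xi)|^2<\infty$. The irrationality measure of $a\in\mathbb R\setminus\mathbb Q$ is $\mu(a)=\sup\{\nu>0:\ |a-p/q|<q^{-\nu}\text{ for infinitely many }(p,q)\in\mathbb Z\times\mathbb N\}\in[2,\infty]$. *)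

theory Defs
  imports "HOL-Analysis.Analysis"
begin

text \<open>
  A function on the torus \<open>(\<real>/2\<pi>\<int>)\<^sup>2\<close> is represented by its lift to the plane, that is, by a
  function of \<open>(t, x)\<close> that is \<open>2\<pi>\<close>-periodic in each variable.
\<close>

definition torus_periodic :: "(real \<times> real \<Rightarrow> complex) \<Rightarrow> bool" where
  "torus_periodic \<phi> \<longleftrightarrow>
     (\<forall>t x. \<phi> (t + 2 * pi, x) = \<phi> (t, x) \<and> \<phi> (t, x + 2 * pi) = \<phi> (t, x))"

primrec times_cont_diff :: "nat \<Rightarrow> (real \<times> real \<Rightarrow> complex) \<Rightarrow> bool" where
  "times_cont_diff 0 \<phi> \<longleftrightarrow> continuous_on UNIV \<phi>"
| "times_cont_diff (Suc k) \<phi> \<longleftrightarrow>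
     (\<forall>p. \<phi> differentiable (at p)) \<and>
     (\<forall>v. times_cont_diff k (\<lambda>p. frechet_derivative \<phi> (at p) v))"

definition test_functions :: "(real \<times> real \<Rightarrow> complex) set" where
  "test_functions = {\<phi>. torus_periodic \<phi> \<and> (\<forall>k. times_cont_diff k \<phi>)}"

definition partial_t :: "(real \<times> real \<Rightarrow> complex) \<Rightarrow> real \<times> real \<Rightarrow> complex" where
  "partial_t \<phi> = (\<lambda>p. frechet_derivative \<phi> (at p) (1, 0))"

definition partial_x :: "(real \<times> real \<Rightarrow> complex) \<Rightarrow> real \<times> real \<Rightarrow> complex" where
  "partial_x \<phi> = (\<lambda>p. frechet_derivative \<phi> (at p) (0, 1))"

definition C_norm :: "nat \<Rightarrow> (real \<times> real \<Rightarrow> complex) \<Rightarrow> real" where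
  "C_norm N \<phi> =
     (\<Sum>(m, n) \<in> {(m, n). m + n \<le> N}. SUP p. norm ((partial_t ^^ m) ((partial_x ^^ n) \<phi>) p))"

text \<open>
  Distributions are the continuous linear functionals on the Frechet space of test functions, whose
  topology is given by the norms \<^const>\<open>C_norm\<close>. They are required to be extensional, i.e. to have
  the fixed value \<^const>\<open>undefined\<close> off the test functions, so that HOL equality is
  equality of distributions.
\<close>

definition distributions :: "((real \<times> real \<Rightarrow> complex) \<Rightarrow> complex) set" where
  "distributions = {u \<in> extensional test_functions.
     (\<forall>\<phi>\<in>test_functions. \<forall>\<psi>\<in>test_functions. u (\<lambda>p. \<phi> p + \<psi> p) = u \<phi> + u \<psi>) \<and>
     (\<forall>\<phi>\<in>test_functions. \<forall>z. u (\<lambda>p. z * \<phi> p) = z * u \<phi>) \<and>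
     (\<exists>N C. \<forall>\<phi>\<in>test_functions. norm (u \<phi>) \<le> C * C_norm N \<phi>)}"

definition dist_partial_t ::
  "((real \<times> real \<Rightarrow> complex) \<Rightarrow> complex) \<Rightarrow> (real \<times> real \<Rightarrow> complex) \<Rightarrow> complex" where
  "dist_partial_t u = (\<lambda>\<phi>\<in>test_functions. - u (partial_t \<phi>))"

definition dist_partial_x ::
  "((real \<times> real \<Rightarrow> complex) \<Rightarrow> complex) \<Rightarrow> (real \<times> real \<Rightarrow> complex) \<Rightarrow> complex" where
  "dist_partial_x u = (\<lambda>\<phi>\<in>test_functions. - u (partial_x \<phi>))"

definition L_op ::
  "complex \<Rightarrow> ((real \<times> real \<Rightarrow> complex) \<Rightarrow> complex) \<Rightarrow> (real \<times> real \<Rightarrow> complex) \<Rightarrow> complex" where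
  "L_op c u = (\<lambda>\<phi>\<in>test_functions. dist_partial_t u \<phi> - c * dist_partial_x u \<phi>)"

text \<open>
  A function \<open>f\<close> acts on test functions by \<open>\<phi> \<mapsto> \<integral> f \<phi>\<close>, bilinearly and
  without the factor \<open>(2\<pi>)\<^sup>-\<^sup>2\<close>; this fixes the normalisation of the Fourier
  coefficients of a distribution.
\<close>

definition fourier_coeff ::
  "((real \<times> real \<Rightarrow> complex) \<Rightarrow> complex) \<Rightarrow> int \<Rightarrow> int \<Rightarrow> complex" where
  "fourier_coeff f \<tau> \<xi> =
     f (\<lambda>(t, x). exp (- (\<i> * of_real (t * of_int \<tau> + x * of_int \<xi>)))) / of_real ((2 * pi)\<^sup>2)"

definition jbracket :: "real \<Rightarrow> real" where
  "jbracket w = (1 + \<bar>w\<bar>\<^sup>2) powr (1 / 2)"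

definition H_mix :: "real \<Rightarrow> real \<Rightarrow> ((real \<times> real \<Rightarrow> complex) \<Rightarrow> complex) set" where
  "H_mix s1 s2 = {f \<in> distributions.
     (\<lambda>(\<tau>, \<xi>). jbracket (of_int \<tau>) powr (2 * s1) * jbracket (of_int \<xi>) powr (2 * s2) *
        (norm (fourier_coeff f \<tau> \<xi>))\<^sup>2) summable_on (UNIV :: (int \<times> int) set)}"

definition irrationality_measure :: "real \<Rightarrow> ereal" where
  "irrationality_measure a =
     Sup (ereal ` {\<nu>. \<nu> > 0 \<and>
       infinite {(p :: int, q :: nat). q > 0 \<and> \<bar>a - of_int p / of_nat q\<bar> < of_nat q powr (- \<nu>)}})"

end

theory Submission
  imports Defs
begin

text \<open>
  \<open>L\<close> multiplies the \<open>(\<tau>, \<xi>)\<close>-th Fourier coefficient by \<open>\<i> (\<tau> - c \<xi>)\<close>, so everything reduces to a bound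
  \<open>\<langle>\<tau>\<rangle>\<^bsup>s\<^esup> \<langle>\<xi>\<rangle>\<^bsup>s'\<^esup> \<le> C \<bar>\<tau> - c \<xi>\<bar>\<close> off the origin: it makes the symbol nonzero there, and division by the
  symbol gains \<open>(s, s')\<close> derivatives. If \<open>b \<noteq> 0\<close> the symbol dominates \<open>\<bar>\<tau>\<bar> + \<bar>\<xi>\<bar>\<close>. If \<open>b = 0\<close>, then
  \<open>\<bar>\<tau> - a \<xi>\<bar> \<ge> c\<^sub>0 \<langle>\<xi>\<rangle>\<^bsup>1-r\<^esup>\<close> for \<open>r > \<mu>(a)\<close>, and \<open>\<langle>\<tau>\<rangle>\<close> and \<open>\<langle>\<xi>\<rangle>\<close> are comparable up to a factor
  \<open>max 1 \<bar>\<tau> - a \<xi>\<bar>\<close>. Distributions correspond to coefficient families of polynomial growth because Fourier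
  series of test functions converge in every norm \<^const>\<open>C_norm\<close>; the only analytic input is that a
  continuous periodic function with vanishing Fourier coefficients is zero (Stone-Weierstrass on the
  product of two circles).
\<close>

section \<open>Characters and test functions\<close>

definition torus_char :: "int \<times> int \<Rightarrow> real \<times> real \<Rightarrow> complex" where
  "torus_char k p = exp (\<i> * of_real (of_int (fst k) * fst p + of_int (snd k) * snd p))"

abbreviation torus_box :: "(real \<times> real) set" where
  "torus_box \<equiv> cbox (0, 0) (2 * pi, 2 * pi)"

text \<open>For a test function this is \<open>fourier_coeff\<close> of the functional that
  integrates against \<phi> over one period. Frequencies are pairs so that their group structure can
  be used, as in \<open>torus_char_add\<close>.\<close>

definition torus_coeff :: "(real \<times> real \<Rightarrow> complex) \<Rightarrow> int \<times> int \<Rightarrow> complex" where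
  "torus_coeff \<phi> k = integral torus_box (\<lambda>p. \<phi> p * torus_char (- k) p) / of_real ((2 * pi)\<^sup>2)"

text \<open>Arbitrary finite frequency sets, rather than squares or balls, match the filter
  \<open>finite_subsets_at_top\<close> behind \<open>has_sum\<close> and
  \<open>infsum\<close>.\<close>

definition fourier_sum ::
  "(int \<times> int) set \<Rightarrow> (real \<times> real \<Rightarrow> complex) \<Rightarrow> real \<times> real \<Rightarrow> complex" where
  "fourier_sum F \<phi> p = (\<Sum>k\<in>F. torus_coeff \<phi> k * torus_char k p)"

lemma norm_torus_char [simp]: "norm (torus_char k p) = 1"
  by (simp add: torus_char_def)

lemma torus_char_0 [simp]: "torus_char 0 p = 1"
  by (simp add: torus_char_def)

lemma torus_char_add: "torus_char (j + k) p = torus_char j p * torus_char k p"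
  by (simp add: torus_char_def algebra_simps flip: exp_add)

lemma has_derivative_torus_char:
  "(torus_char k has_derivative
     (\<lambda>v. \<i> * of_real (of_int (fst k) * fst v + of_int (snd k) * snd v) * torus_char k p)) (at p)"
proof -
  have "((\<lambda>p. \<i> * complex_of_real (of_int (fst k) * fst p + of_int (snd k) * snd p)) has_derivative
     (\<lambda>v. \<i> * of_real (of_int (fst k) * fst v + of_int (snd k) * snd v))) (at p)"
    by (intro derivative_intros)
  from has_derivative_compose[OF this DERIV_exp[unfolded has_field_derivative_def]] show ?thesis
    unfolding torus_char_def by (simp add: mult_ac)
qed

lemma continuous_on_torus_char [continuous_intros]:
  "continuous_on S f \<Longrightarrow> continuous_on S (\<lambda>x. torus_char k (f x))"
  unfolding torus_char_def by (intro continuous_intros)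

lemma exp_2pi_int: "exp (\<i> * of_real (of_int m * (2 * pi))) = 1"
  using exp_integer_2pi[of "of_int m"] by (simp add: mult_ac)

lemma torus_periodic_char: "torus_periodic (torus_char k)"
proof -
  have "torus_char k (t + 2 * pi, x) = torus_char k (t, x) * exp (\<i> * of_real (of_int (fst k) * (2 * pi)))"
    for t x by (simp add: torus_char_def algebra_simps flip: exp_add)
  moreover have "torus_char k (t, x + 2 * pi) = torus_char k (t, x) * exp (\<i> * of_real (of_int (snd k) * (2 * pi)))"
    for t x by (simp add: torus_char_def algebra_simps flip: exp_add)
  ultimately show ?thesis
    unfolding torus_periodic_def exp_2pi_int by simp
qed

lemma frechet_derivative_eqI: "(f has_derivative f') (at p) \<Longrightarrow> frechet_derivative f (at p) v = f' v"
  using frechet_derivative_at by metis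

lemma times_cont_diff_SucD:
  assumes "times_cont_diff (Suc k) \<phi>"
  shows "\<phi> differentiable (at p)" "times_cont_diff k (\<lambda>p. frechet_derivative \<phi> (at p) v)"
  using assms unfolding times_cont_diff.simps by blast+

lemma times_cont_diff_add:
  "times_cont_diff k \<phi> \<Longrightarrow> times_cont_diff k \<psi> \<Longrightarrow> times_cont_diff k (\<lambda>p. \<phi> p + \<psi> p)"
proof (induction k arbitrary: \<phi> \<psi>)
  case (Suc k)
  have diff: "\<phi> differentiable (at p)" "\<psi> differentiable (at p)" for p
    using Suc.prems times_cont_diff_SucD(1) by blast+
  have "frechet_derivative (\<lambda>p. \<phi> p + \<psi> p) (at p) v
      = frechet_derivative \<phi> (at p) v + frechet_derivative \<psi> (at p) v" for p v
    using diff by (intro frechet_derivative_eqI has_derivative_add) (simp_all flip: frechet_derivative_works)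
  with Suc diff show ?case
    unfolding times_cont_diff.simps by (auto intro!: differentiable_add)
qed (auto intro: continuous_intros)

lemma times_cont_diff_cmult:
  "times_cont_diff k \<phi> \<Longrightarrow> times_cont_diff k (\<lambda>p. z * \<phi> p)"
proof (induction k arbitrary: \<phi>)
  case (Suc k)
  have diff: "\<phi> differentiable (at p)" for p
    using Suc.prems times_cont_diff_SucD(1) by blast+
  have "frechet_derivative (\<lambda>p. z * \<phi> p) (at p) v = z * frechet_derivative \<phi> (at p) v" for p v
    using diff by (intro frechet_derivative_eqI has_derivative_mult_right) (simp flip: frechet_derivative_works)
  with Suc diff show ?case
    unfolding times_cont_diff.simps by (auto intro!: differentiable_mult)
qed (auto intro: continuous_intros)

lemma times_cont_diff_torus_char: "times_cont_diff k (torus_char j)"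
proof -
  \<comment> \<open>A directional derivative of a character is a constant multiple of the same
    character, so the induction carries an arbitrary factor \<open>z\<close>.\<close>
  have "times_cont_diff k (\<lambda>p. z * torus_char j p)" for z
  proof (induction k arbitrary: z)
    case (Suc k)
    have D: "((\<lambda>p. z * torus_char j p) has_derivative
        (\<lambda>v. z * (\<i> * of_real (of_int (fst j) * fst v + of_int (snd j) * snd v) * torus_char j p))) (at p)" for p
      by (intro has_derivative_mult_right has_derivative_torus_char)
    show ?case
      unfolding times_cont_diff.simps frechet_derivative_eqI[OF D]
      using differentiableI[OF D] Suc by (simp add: mult.assoc[symmetric])
  qed (auto intro!: continuous_intros)
  from this[of 1] show ?thesis by simp
qed

lemma torus_periodic_add:
  "torus_periodic \<phi> \<Longrightarrow> torus_periodic \<psi> \<Longrightarrow> torus_periodic (\<lambda>p. \<phi> p + \<psi> p)"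
  by (simp add: torus_periodic_def)

lemma torus_periodic_cmult: "torus_periodic \<phi> \<Longrightarrow> torus_periodic (\<lambda>p. z * \<phi> p)"
  by (simp add: torus_periodic_def)

lemma test_functions_add:
  "\<phi> \<in> test_functions \<Longrightarrow> \<psi> \<in> test_functions \<Longrightarrow> (\<lambda>p. \<phi> p + \<psi> p) \<in> test_functions"
  by (simp add: test_functions_def times_cont_diff_add torus_periodic_add)

lemma test_functions_cmult: "\<phi> \<in> test_functions \<Longrightarrow> (\<lambda>p. z * \<phi> p) \<in> test_functions"
  by (simp add: test_functions_def times_cont_diff_cmult torus_periodic_cmult)

lemma torus_char_test: "torus_char k \<in> test_functions"
  by (simp add: test_functions_def times_cont_diff_torus_char torus_periodic_char)

lemma test_functions_sum:
  "finite F \<Longrightarrow> (\<And>k. k \<in> F \<Longrightarrow> g k \<in> test_functions) \<Longrightarrow> (\<lambda>p. \<Sum>k\<in>F. g k p) \<in> test_functions"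
proof (induction F rule: finite_induct)
  case empty
  then show ?case using test_functions_cmult[OF torus_char_test, of 0 0] by simp
next
  case (insert k F)
  then show ?case by (simp add: test_functions_add)
qed

lemma fourier_sum_test: "finite F \<Longrightarrow> fourier_sum F \<phi> \<in> test_functions"
  unfolding fourier_sum_def[abs_def]
  by (intro test_functions_sum test_functions_cmult torus_char_test)

lemma test_functions_diff:
  "\<phi> \<in> test_functions \<Longrightarrow> \<psi> \<in> test_functions \<Longrightarrow> (\<lambda>p. \<phi> p - \<psi> p) \<in> test_functions"
  using test_functions_add[OF _ test_functions_cmult[of \<psi> "-1"]] by simp

lemma test_functions_continuous: "\<phi> \<in> test_functions \<Longrightarrow> continuous_on S \<phi>"
  unfolding test_functions_def using continuous_on_subset
  by (metis (mono_tags, lifting) mem_Collect_eq subset_UNIV times_cont_diff.simps(1))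

lemma test_functions_periodic: "\<phi> \<in> test_functions \<Longrightarrow> torus_periodic \<phi>"
  by (simp add: test_functions_def)

lemma test_functions_has_derivative:
  assumes "\<phi> \<in> test_functions"
  shows "(\<phi> has_derivative frechet_derivative \<phi> (at p)) (at p)"
proof -
  have "times_cont_diff (Suc 0) \<phi>"
    using assms by (simp only: test_functions_def mem_Collect_eq)
  then show ?thesis
    using frechet_derivative_works times_cont_diff_SucD(1) by blast
qed

lemma frechet_derivative_test:
  assumes "\<phi> \<in> test_functions"
  shows "(\<lambda>p. frechet_derivative \<phi> (at p) v) \<in> test_functions"
proof -
  have per: "torus_periodic \<phi>" and "\<And>k. times_cont_diff (Suc k) \<phi>"
    using assms by (simp_all only: test_functions_def mem_Collect_eq)
  \<comment> \<open>A period of \<phi> is a period of its derivative, by the chain rule for the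
    translation and uniqueness of derivatives.\<close>
  have shift: "frechet_derivative \<phi> (at (p + d)) = frechet_derivative \<phi> (at p)"
    if "\<And>q. \<phi> (q + d) = \<phi> q" for p d
  proof -
    have "((\<lambda>q. \<phi> (q + d)) has_derivative frechet_derivative \<phi> (at (p + d))) (at p)"
      by (rule has_derivative_compose[where g = \<phi> and f = "\<lambda>q. q + d", simplified])
         (auto intro!: derivative_eq_intros test_functions_has_derivative assms)
    then show ?thesis
      using frechet_derivative_at that by (metis (no_types, lifting) ext)
  qed
  have "torus_periodic (\<lambda>p. frechet_derivative \<phi> (at p) v)"
    using per shift[of "(2 * pi, 0)"] shift[of "(0, 2 * pi)"]
    by (auto simp: torus_periodic_def)
  with \<open>\<And>k. times_cont_diff (Suc k) \<phi>\<close> show ?thesis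
    unfolding test_functions_def using times_cont_diff_SucD(2) by blast
qed

lemma partial_t_test: "\<phi> \<in> test_functions \<Longrightarrow> partial_t \<phi> \<in> test_functions"
  and partial_x_test: "\<phi> \<in> test_functions \<Longrightarrow> partial_x \<phi> \<in> test_functions"
  unfolding partial_t_def partial_x_def by (rule frechet_derivative_test; assumption)+

lemma partial_iter_test:
  assumes "\<phi> \<in> test_functions"
  shows "(partial_t ^^ m) ((partial_x ^^ n) \<phi>) \<in> test_functions"
proof -
  have "(partial_x ^^ n) \<phi> \<in> test_functions"
    by (induction n) (auto simp: assms partial_x_test)
  then show ?thesis
    by (induction m) (auto simp: partial_t_test)
qed

lemma partial_torus_char:
  "partial_t (torus_char k) = (\<lambda>p. \<i> * of_int (fst k) * torus_char k p)"
  "partial_x (torus_char k) = (\<lambda>p. \<i> * of_int (snd k) * torus_char k p)"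
  unfolding partial_t_def partial_x_def
  by (simp_all add: frechet_derivative_eqI[OF has_derivative_torus_char])

lemma partial_fourier_remainder:
  assumes "\<phi> \<in> test_functions"
  shows "partial_t (\<lambda>p. \<phi> p - fourier_sum F \<phi> p) =
      (\<lambda>p. partial_t \<phi> p - (\<Sum>k\<in>F. \<i> * of_int (fst k) * torus_coeff \<phi> k * torus_char k p))"
    and "partial_x (\<lambda>p. \<phi> p - fourier_sum F \<phi> p) =
      (\<lambda>p. partial_x \<phi> p - (\<Sum>k\<in>F. \<i> * of_int (snd k) * torus_coeff \<phi> k * torus_char k p))"
proof -
  have D: "((\<lambda>p. \<phi> p - fourier_sum F \<phi> p) has_derivative (\<lambda>v. frechet_derivative \<phi> (at p) v -
      (\<Sum>k\<in>F. torus_coeff \<phi> k * (\<i> * of_real (of_int (fst k) * fst v + of_int (snd k) * snd v) * torus_char k p)))) (at p)"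
    for p unfolding fourier_sum_def
    by (intro has_derivative_diff has_derivative_sum has_derivative_mult_right
          has_derivative_torus_char test_functions_has_derivative assms)
  show "partial_t (\<lambda>p. \<phi> p - fourier_sum F \<phi> p) =
      (\<lambda>p. partial_t \<phi> p - (\<Sum>k\<in>F. \<i> * of_int (fst k) * torus_coeff \<phi> k * torus_char k p))"
    "partial_x (\<lambda>p. \<phi> p - fourier_sum F \<phi> p) =
      (\<lambda>p. partial_x \<phi> p - (\<Sum>k\<in>F. \<i> * of_int (snd k) * torus_coeff \<phi> k * torus_char k p))"
    unfolding partial_t_def partial_x_def frechet_derivative_eqI[OF D]
    by (simp_all add: mult_ac)
qed

section \<open>Fourier coefficients\<close>

lemma periodic_shift_int:
  fixes g :: "real \<Rightarrow> 'a"
  assumes "\<And>t. g (t + c) = g t"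
  shows "g (t + c * of_int m) = g t"
proof -
  have nat: "g (t + c * of_nat j) = g t" for t j
  proof (induction j)
    case (Suc j)
    have "t + c * of_nat (Suc j) = (t + c * of_nat j) + c" by (simp add: algebra_simps)
    then show ?case by (simp only: assms Suc)
  qed simp
  show ?thesis
  proof (cases "m \<ge> 0")
    case True
    then show ?thesis using nat[of t "nat m"] by simp
  next
    case False
    then have "t + c * of_int m + c * of_nat (nat (- m)) = t" by (simp add: algebra_simps)
    then show ?thesis using nat[of "t + c * of_int m" "nat (- m)"] by (simp only:)
  qed
qed

lemma torus_periodic_shift:
  assumes "torus_periodic \<phi>"
  shows "\<phi> (t + 2 * pi * of_int m, x + 2 * pi * of_int n) = \<phi> (t, x)"
proof -
  have "\<phi> (t + 2 * pi * of_int m, x') = \<phi> (t, x')" for x'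
    using assms by (intro periodic_shift_int[of "\<lambda>t. \<phi> (t, x')"]) (simp add: torus_periodic_def)
  moreover have "\<phi> (t, x + 2 * pi * of_int n) = \<phi> (t, x)"
    using assms by (intro periodic_shift_int[of "\<lambda>x. \<phi> (t, x)"]) (simp add: torus_periodic_def)
  ultimately show ?thesis by simp
qed

text \<open>Equal points of the circle have angles that differ by a multiple of 2 * pi. In this form
  any branch of the argument may serve as a coordinate.\<close>

lemma torus_periodic_cong:
  assumes "torus_periodic \<phi>" "exp (\<i> * of_real t) = exp (\<i> * of_real t')"
    "exp (\<i> * of_real x) = exp (\<i> * of_real x')"
  shows "\<phi> (t, x) = \<phi> (t', x')"
proof -
  have *: "\<exists>n. s = s' + 2 * pi * of_int n" if "exp (\<i> * of_real s) = exp (\<i> * of_real s')" for s s' :: real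
  proof -
    from that obtain n :: int where "\<i> * of_real s = \<i> * of_real s' + (of_int (2 * n) * pi) * \<i>"
      unfolding exp_eq by blast
    then have "Im (\<i> * of_real s) = Im (\<i> * of_real s' + (of_int (2 * n) * pi) * \<i>)" by simp
    then show ?thesis by (intro exI[of _ n]) simp
  qed
  show ?thesis
    using *[OF assms(2)] *[OF assms(3)] torus_periodic_shift[OF assms(1)] by auto
qed

text \<open>\<open>Arg2pi\<close> selects a representative within one period. Compactness of the box
  then turns continuity into global bounds.\<close>

lemma torus_periodic_box:
  assumes "torus_periodic \<phi>"
  shows "\<exists>q\<in>torus_box. \<phi> q = \<phi> p"
proof -
  define s where "s t = Arg2pi (exp (\<i> * of_real t))" for t
  have s: "0 \<le> s t" "s t \<le> 2 * pi" "exp (\<i> * of_real (s t)) = exp (\<i> * of_real t)" for t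
    using Arg2pi[of "exp (\<i> * of_real t)"] by (auto simp: s_def is_Arg_def)
  show ?thesis
    using s torus_periodic_cong[OF assms s(3) s(3), of "fst p" "snd p"]
    by (intro bexI[of _ "(s (fst p), s (snd p))"]) auto
qed

lemma test_functions_bdd:
  assumes "\<phi> \<in> test_functions"
  shows "bdd_above (range (\<lambda>p. norm (\<phi> p)))"
proof -
  have "bounded (\<phi> ` torus_box)"
    by (intro compact_imp_bounded compact_continuous_image test_functions_continuous assms compact_cbox)
  then obtain B where B: "\<And>q. q \<in> torus_box \<Longrightarrow> norm (\<phi> q) \<le> B"
    unfolding bounded_iff by auto
  show ?thesis
    using B torus_periodic_box[OF test_functions_periodic[OF assms]]
    by (intro bdd_aboveI[of _ B]) (metis rangeE)
qed

section \<open>Integration over one period and coefficients of derivatives\<close>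

lemma norm_integral_torus_box_le:
  fixes g :: "real \<times> real \<Rightarrow> complex"
  assumes "continuous_on UNIV g" "\<And>p. norm (g p) \<le> B"
  shows "norm (integral torus_box g) \<le> B * (2 * pi)\<^sup>2"
proof -
  have "0 \<le> B" using assms(2)[of 0] norm_ge_zero order_trans by blast
  moreover have "(g has_integral integral torus_box g) torus_box"
    by (intro integrable_integral integrable_continuous continuous_on_subset[OF assms(1)]) auto
  ultimately have "norm (integral torus_box g) \<le> B * measure lborel torus_box"
    using assms(2) by (rule has_integral_bound)
  then show ?thesis by (simp add: content_Pair power2_eq_square)
qed

lemma norm_torus_coeff_le:
  assumes "continuous_on UNIV \<phi>" "\<And>p. norm (\<phi> p) \<le> B"
  shows "norm (torus_coeff \<phi> k) \<le> B"
proof -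
  have "norm (integral torus_box (\<lambda>p. \<phi> p * torus_char (- k) p)) \<le> B * (2 * pi)\<^sup>2"
    using assms by (intro norm_integral_torus_box_le continuous_intros) (auto simp: norm_mult)
  then show ?thesis
    by (simp add: torus_coeff_def norm_divide norm_power divide_le_eq power_mult_distrib)
qed

lemma integrable_torus_box:
  fixes g :: "real \<times> real \<Rightarrow> 'a::banach"
  shows "continuous_on UNIV g \<Longrightarrow> g integrable_on torus_box"
  by (rule integrable_continuous) (rule continuous_on_subset, auto)

lemma torus_coeff_add:
  assumes "continuous_on UNIV \<phi>" "continuous_on UNIV \<psi>"
  shows "torus_coeff (\<lambda>p. \<phi> p + \<psi> p) k = torus_coeff \<phi> k + torus_coeff \<psi> k"
proof -
  have "(\<lambda>p. \<phi> p * torus_char (- k) p) integrable_on torus_box"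
    "(\<lambda>p. \<psi> p * torus_char (- k) p) integrable_on torus_box"
    by (intro integrable_torus_box continuous_intros assms)+
  then show ?thesis
    by (simp add: torus_coeff_def distrib_right integral_add add_divide_distrib)
qed

lemma torus_coeff_cmult: "torus_coeff (\<lambda>p. z * \<phi> p) k = z * torus_coeff \<phi> k"
  unfolding torus_coeff_def mult.assoc by simp

text \<open>The fundamental theorem of calculus in the differentiated variable leaves boundary terms
  that cancel by periodicity. For the first variable the iterated integral is swapped
  beforehand.\<close>

lemma integral_torus_box_derivative:
  assumes D: "continuous_on UNIV D" and G: "torus_periodic G"
  shows "(\<And>t x. ((\<lambda>s. G (s, x)) has_vector_derivative D (t, x)) (at t)) \<Longrightarrow> integral torus_box D = 0"
    and "(\<And>t x. ((\<lambda>s. G (t, s)) has_vector_derivative D (t, x)) (at x)) \<Longrightarrow> integral torus_box D = 0"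
proof -
  have per: "G (2 * pi, x) = G (0, x)" "G (t, 2 * pi) = G (t, 0)" for t x
    using G unfolding torus_periodic_def by (metis add_0)+
  have I: "integral torus_box D = integral {0..2*pi} (\<lambda>t. integral {0..2*pi} (\<lambda>x. D (t, x)))"
    using integral_prod_continuous[of 0 0 "2 * pi" "2 * pi" D] continuous_on_subset[OF D] by simp
  {
    assume *: "\<And>t x. ((\<lambda>s. G (t, s)) has_vector_derivative D (t, x)) (at x)"
    have "((\<lambda>x. D (t, x)) has_integral (G (t, 2 * pi) - G (t, 0))) {0..2*pi}" for t
      using * by (intro fundamental_theorem_of_calculus) (auto intro: has_vector_derivative_at_within)
    then have "integral {0..2*pi} (\<lambda>x. D (t, x)) = 0" for t
      using per by (simp add: integral_unique)
    then show "integral torus_box D = 0"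
      unfolding I by simp
  next
    assume *: "\<And>t x. ((\<lambda>s. G (s, x)) has_vector_derivative D (t, x)) (at t)"
    have "((\<lambda>t. D (t, x)) has_integral (G (2 * pi, x) - G (0, x))) {0..2*pi}" for x
      using * by (intro fundamental_theorem_of_calculus) (auto intro: has_vector_derivative_at_within)
    then have "integral {0..2*pi} (\<lambda>t. D (t, x)) = 0" for x
      using per by (simp add: integral_unique)
    moreover have "integral torus_box D = integral {0..2*pi} (\<lambda>x. integral {0..2*pi} (\<lambda>t. D (t, x)))"
      unfolding I using integral_swap_continuous[of 0 0 "2 * pi" "2 * pi" "\<lambda>t x. D (t, x)"] continuous_on_subset[OF D]
      by (simp add: split_def)
    ultimately show "integral torus_box D = 0" by simp
  }
qed

text \<open>Integration by parts: the product \<open>G\<close> of \<phi> and the conjugate character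
  is periodic, so its partial derivatives integrate to zero.\<close>

lemma torus_coeff_partial:
  assumes "\<phi> \<in> test_functions"
  shows "torus_coeff (partial_t \<phi>) k = \<i> * of_int (fst k) * torus_coeff \<phi> k"
    and "torus_coeff (partial_x \<phi>) k = \<i> * of_int (snd k) * torus_coeff \<phi> k"
proof -
  define G where "G p = \<phi> p * torus_char (- k) p" for p
  have G': "(G has_derivative (\<lambda>v. frechet_derivative \<phi> (at p) v * torus_char (- k) p
      - \<i> * of_real (of_int (fst k) * fst v + of_int (snd k) * snd v) * G p)) (at p)" for p
    unfolding G_def
    by (rule derivative_eq_intros test_functions_has_derivative[OF assms] has_derivative_torus_char refl)+
       (auto simp: algebra_simps)
  \<comment> \<open>Linearity turns the increments \<open>h *\<^sub>R (1, 0)\<close> and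
    \<open>h *\<^sub>R (0, 1)\<close> into scalar multiples, the shape that
    \<open>has_vector_derivative\<close> asks for.\<close>
  have lin: "linear (\<lambda>v. frechet_derivative \<phi> (at p) v * torus_char (- k) p
      - \<i> * of_real (of_int (fst k) * fst v + of_int (snd k) * snd v) * G p)" for p
    using G' has_derivative_linear by blast
  have perG: "torus_periodic G"
    using test_functions_periodic[OF assms] torus_periodic_char[of "- k"]
    by (simp add: torus_periodic_def G_def)
  have contG: "continuous_on UNIV G"
    unfolding G_def by (intro continuous_intros test_functions_continuous assms)
  have cont: "continuous_on UNIV (\<lambda>p. partial_t \<phi> p * torus_char (- k) p)"
      "continuous_on UNIV (\<lambda>p. partial_x \<phi> p * torus_char (- k) p)"
    by (intro continuous_intros test_functions_continuous partial_t_test partial_x_test assms)+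
  have "integral torus_box (\<lambda>p. partial_t \<phi> p * torus_char (- k) p - \<i> * of_int (fst k) * G p) = 0"
  proof (rule integral_torus_box_derivative(1)[OF _ perG])
    show "continuous_on UNIV (\<lambda>p. partial_t \<phi> p * torus_char (- k) p - \<i> * of_int (fst k) * G p)"
      by (intro continuous_intros cont contG)
    fix t x :: real
    have "((\<lambda>s. (s, x)) has_derivative (\<lambda>h. (h, 0))) (at t)"
      by (auto intro!: derivative_eq_intros)
    from has_derivative_compose[OF this G']
    have "((\<lambda>s. G (s, x)) has_derivative (\<lambda>h. (\<lambda>v. frechet_derivative \<phi> (at (t, x)) v * torus_char (- k) (t, x)
      - \<i> * of_real (of_int (fst k) * fst v + of_int (snd k) * snd v) * G (t, x)) (h *\<^sub>R (1, 0)))) (at t)"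
      by simp
    then show "((\<lambda>s. G (s, x)) has_vector_derivative
      (partial_t \<phi> (t, x) * torus_char (- k) (t, x) - \<i> * of_int (fst k) * G (t, x))) (at t)"
      unfolding linear_cmul[OF lin] by (simp add: has_vector_derivative_def partial_t_def)
  qed
  then show "torus_coeff (partial_t \<phi>) k = \<i> * of_int (fst k) * torus_coeff \<phi> k"
    unfolding integral_diff[OF integrable_torus_box[OF cont(1)] integrable_torus_box[OF continuous_on_mult_left[OF contG]]]
    by (simp add: torus_coeff_def G_def)
  have "integral torus_box (\<lambda>p. partial_x \<phi> p * torus_char (- k) p - \<i> * of_int (snd k) * G p) = 0"
  proof (rule integral_torus_box_derivative(2)[OF _ perG])
    show "continuous_on UNIV (\<lambda>p. partial_x \<phi> p * torus_char (- k) p - \<i> * of_int (snd k) * G p)"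
      by (intro continuous_intros cont contG)
    fix t x :: real
    have "((\<lambda>s. (t, s)) has_derivative (\<lambda>h. (0, h))) (at x)"
      by (auto intro!: derivative_eq_intros)
    from has_derivative_compose[OF this G']
    have "((\<lambda>s. G (t, s)) has_derivative (\<lambda>h. (\<lambda>v. frechet_derivative \<phi> (at (t, x)) v * torus_char (- k) (t, x)
      - \<i> * of_real (of_int (fst k) * fst v + of_int (snd k) * snd v) * G (t, x)) (h *\<^sub>R (0, 1)))) (at x)"
      by simp
    then show "((\<lambda>s. G (t, s)) has_vector_derivative
      (partial_x \<phi> (t, x) * torus_char (- k) (t, x) - \<i> * of_int (snd k) * G (t, x))) (at x)"
      unfolding linear_cmul[OF lin] by (simp add: has_vector_derivative_def partial_x_def)
  qed
  then show "torus_coeff (partial_x \<phi>) k = \<i> * of_int (snd k) * torus_coeff \<phi> k"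
    unfolding integral_diff[OF integrable_torus_box[OF cont(2)] integrable_torus_box[OF continuous_on_mult_left[OF contG]]]
    by (simp add: torus_coeff_def G_def)
qed

text \<open>Orthogonality needs no integral: the coefficients of the eigenfunction \<open>torus_char j\<close> of
  both partial derivatives vanish except at the eigenvalue pair \<open>j\<close>.\<close>
lemma torus_coeff_char: "torus_coeff (torus_char j) k = (if j = k then 1 else 0)"
proof (cases "j = k")
  case True
  have "torus_char j p * torus_char (- j) p = 1" for p
    by (simp flip: torus_char_add)
  with True show ?thesis
    by (simp add: torus_coeff_def content_Pair power2_eq_square scaleR_conv_of_real)
next
  case False
  have "of_int (fst j) * torus_coeff (torus_char j) k = of_int (fst k) * torus_coeff (torus_char j) k"
       "of_int (snd j) * torus_coeff (torus_char j) k = of_int (snd k) * torus_coeff (torus_char j) k"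
    using torus_coeff_partial[OF torus_char_test, of j k]
    by (simp_all add: partial_torus_char torus_coeff_cmult)
  with False show ?thesis by (auto simp: prod_eq_iff)
qed

lemma torus_coeff_partial_iter:
  assumes "\<phi> \<in> test_functions"
  shows "torus_coeff ((partial_t ^^ m) ((partial_x ^^ n) \<phi>)) k =
    (\<i> * of_int (fst k)) ^ m * ((\<i> * of_int (snd k)) ^ n * torus_coeff \<phi> k)"
proof -
  have "torus_coeff ((partial_x ^^ n) \<phi>) k = (\<i> * of_int (snd k)) ^ n * torus_coeff \<phi> k"
  proof (induction n)
    case (Suc n)
    then show ?case
      using torus_coeff_partial(2)[of "(partial_x ^^ n) \<phi>" k] partial_iter_test[OF assms, of 0 n] by simp
  qed simp
  then show ?thesis
  proof (induction m)
    case (Suc m)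
    then show ?case
      using torus_coeff_partial(1)[of "(partial_t ^^ m) ((partial_x ^^ n) \<phi>)" k] partial_iter_test[OF assms, of m n] by simp
  qed simp
qed

section \<open>Decay and summability of the coefficients of test functions\<close>

lemma finite_multi_indices: "finite {(m, n). m + n \<le> (N :: nat)}"
  by (rule finite_subset[of _ "{..N} \<times> {..N}"]) auto

lemma norm_le_SUP_test:
  "\<phi> \<in> test_functions \<Longrightarrow> norm (\<phi> p) \<le> (SUP p. norm (\<phi> p))"
  by (intro cSUP_upper test_functions_bdd) auto

lemma SUP_le_C_norm:
  assumes "\<phi> \<in> test_functions" "m + n \<le> N"
  shows "(SUP p. norm ((partial_t ^^ m) ((partial_x ^^ n) \<phi>) p)) \<le> C_norm N \<phi>"
proof -
  have "0 \<le> (SUP p. norm ((partial_t ^^ m) ((partial_x ^^ n) \<phi>) p))" for m n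
    using norm_le_SUP_test[OF partial_iter_test[OF assms(1)], of m n 0] norm_ge_zero order_trans by blast
  then show ?thesis
    using member_le_sum[of "(m, n)" "{(m, n). m + n \<le> N}"
        "\<lambda>(m, n). SUP p. norm ((partial_t ^^ m) ((partial_x ^^ n) \<phi>) p)"] assms finite_multi_indices
    by (auto simp: C_norm_def)
qed

text \<open>Unlike 1 + |k|^2, a product has a reciprocal whose double sum splits into two single
  sums. It also suits bounds with separate powers of the two frequencies.\<close>

definition torus_weight :: "int \<times> int \<Rightarrow> real" where
  "torus_weight k = (1 + (of_int (fst k))\<^sup>2) * (1 + (of_int (snd k))\<^sup>2)"

lemma torus_weight_ge_1: "1 \<le> torus_weight k"
  using mult_mono[of 1 "1 + (of_int (fst k))\<^sup>2" 1 "1 + (of_int (snd k))\<^sup>2 :: real"]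
  by (simp add: torus_weight_def)

text \<open>Replacing 1 + x^2 by twice its larger term keeps only the powers 0 and 2 * M, so that
  few derivatives have to be controlled.\<close>

lemma one_plus_square_power_le: "(1 + x\<^sup>2) ^ M \<le> 2 ^ M * (1 + \<bar>x\<bar> ^ (2 * M))" for x :: real
proof -
  have "(1 + x\<^sup>2) ^ M \<le> (2 * max 1 (x\<^sup>2)) ^ M"
    by (intro power_mono) auto
  also have "\<dots> = 2 ^ M * (max 1 (x\<^sup>2)) ^ M"
    by (simp add: power_mult_distrib)
  also have "(max 1 (x\<^sup>2)) ^ M \<le> 1 + \<bar>x\<bar> ^ (2 * M)"
    by (auto simp: max_def power_mult)
  finally show ?thesis by simp
qed

text \<open>A monomial in the frequencies times a coefficient is, in modulus, a coefficient of a
  derivative, hence at most one of the suprema in \<open>C_norm\<close>.\<close>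

lemma torus_coeff_decay:
  assumes "\<phi> \<in> test_functions"
  shows "norm (torus_coeff \<phi> k) * torus_weight k ^ M \<le> 4 ^ Suc M * C_norm (4 * M) \<phi>"
proof -
  define A where "A m n = \<bar>of_int (fst k)\<bar> ^ m * (\<bar>of_int (snd k)\<bar> ^ n * norm (torus_coeff \<phi> k))" for m n
  have A: "A m n \<le> C_norm (4 * M) \<phi>" if "m + n \<le> 4 * M" for m n
  proof -
    have t: "(partial_t ^^ m) ((partial_x ^^ n) \<phi>) \<in> test_functions"
      by (rule partial_iter_test[OF assms])
    have "A m n = norm (torus_coeff ((partial_t ^^ m) ((partial_x ^^ n) \<phi>)) k)"
      by (simp add: A_def torus_coeff_partial_iter[OF assms] norm_mult norm_power)
    also have "\<dots> \<le> (SUP p. norm ((partial_t ^^ m) ((partial_x ^^ n) \<phi>) p))"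
      by (intro norm_torus_coeff_le test_functions_continuous norm_le_SUP_test t)
    finally show ?thesis using SUP_le_C_norm[OF assms that] by linarith
  qed
  have "torus_weight k ^ M \<le> (2 ^ M * (1 + \<bar>of_int (fst k)\<bar> ^ (2 * M))) * (2 ^ M * (1 + \<bar>of_int (snd k)\<bar> ^ (2 * M)))"
    unfolding torus_weight_def power_mult_distrib
    by (intro mult_mono one_plus_square_power_le) auto
  then have "norm (torus_coeff \<phi> k) * torus_weight k ^ M \<le> norm (torus_coeff \<phi> k) *
     ((2 ^ M * (1 + \<bar>of_int (fst k)\<bar> ^ (2 * M))) * (2 ^ M * (1 + \<bar>of_int (snd k)\<bar> ^ (2 * M))))"
    by (rule mult_left_mono) simp
  also have "\<dots> = (2 ^ M * 2 ^ M) * (A 0 0 + A (2 * M) 0 + A 0 (2 * M) + A (2 * M) (2 * M))"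
    by (simp add: A_def algebra_simps)
  also have "(2::real) ^ M * 2 ^ M = 4 ^ M"
    by (simp flip: power_mult_distrib)
  \<comment> \<open>The four monomials have total degree at most 4 * M, which fixes the order of the
    norm; their number gives the extra factor 4.\<close>
  also have "4 ^ M * (A 0 0 + A (2 * M) 0 + A 0 (2 * M) + A (2 * M) (2 * M)) \<le> 4 ^ M * (4 * C_norm (4 * M) \<phi>)"
    using A[of 0 0] A[of "2 * M" 0] A[of 0 "2 * M"] A[of "2 * M" "2 * M"] by (intro mult_left_mono) auto
  finally show ?thesis by simp
qed

lemma summable_inverse_one_plus_square: "(\<lambda>m :: int. 1 / (1 + (of_int m)\<^sup>2) :: real) summable_on UNIV"
proof -
  have nat: "(\<lambda>n :: nat. 1 / (1 + (of_nat n)\<^sup>2) :: real) summable_on UNIV"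
  proof -
    have "summable (\<lambda>n. 1 / (1 + (real n)\<^sup>2))"
    proof (rule summable_comparison_test)
      show "summable (\<lambda>n. inverse ((real n) ^ 2))" by (rule inverse_power_summable) simp
      show "\<exists>N. \<forall>n\<ge>N. norm (1 / (1 + (real n)\<^sup>2)) \<le> inverse ((real n)\<^sup>2)"
        by (intro exI[of _ 1]) (auto simp: divide_inverse intro!: le_imp_inverse_le)
    qed
    then show ?thesis by (intro summable_nonneg_imp_summable_on) auto
  qed
  have "(\<lambda>m :: int. 1 / (1 + (of_int m)\<^sup>2) :: real) summable_on (range int \<union> range (\<lambda>n. - int n))"
  proof (rule summable_on_union)
    show "(\<lambda>m :: int. 1 / (1 + (of_int m)\<^sup>2) :: real) summable_on range int"
      by (subst summable_on_reindex) (use nat in \<open>simp_all add: o_def\<close>)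
    show "(\<lambda>m :: int. 1 / (1 + (of_int m)\<^sup>2) :: real) summable_on range (\<lambda>n. - int n)"
      by (subst summable_on_reindex) (use nat in \<open>simp_all add: o_def inj_on_def\<close>)
  qed
  moreover have "m \<in> range int \<union> range (\<lambda>n. - int n)" for m
    by (cases m rule: int_cases2) auto
  then have "range int \<union> range (\<lambda>n. - int n) = UNIV" by blast
  ultimately show ?thesis by simp
qed

lemma summable_inverse_torus_weight: "(\<lambda>k. 1 / torus_weight k) summable_on UNIV"
proof -
  let ?g = "\<lambda>m :: int. 1 / (1 + (of_int m)\<^sup>2) :: real"
  have "(\<lambda>k. 1 / torus_weight k) summable_on (SIGMA m:UNIV. UNIV)"
  proof (rule summable_on_SigmaI)
    show "((\<lambda>n. 1 / torus_weight (m, n)) has_sum ?g m * infsum ?g UNIV) UNIV" for m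
      using has_sum_cmult_right[OF has_sum_infsum[OF summable_inverse_one_plus_square], of "?g m"]
      by (simp add: torus_weight_def)
    show "(\<lambda>m. ?g m * infsum ?g UNIV) summable_on UNIV"
      by (intro summable_on_cmult_left summable_inverse_one_plus_square)
    show "0 \<le> 1 / torus_weight (m, n)" for m n
      using torus_weight_ge_1[of "(m, n)"] by simp
  qed
  then show ?thesis by simp
qed

lemma torus_coeff_abs_summable:
  assumes "\<phi> \<in> test_functions"
  shows "(\<lambda>k. norm (torus_coeff \<phi> k)) summable_on UNIV"
proof (rule summable_on_comparison_test)
  show "(\<lambda>k. 4 ^ Suc 1 * C_norm (4 * 1) \<phi> * (1 / torus_weight k)) summable_on UNIV"
    by (intro summable_on_cmult_right summable_inverse_torus_weight)
  show "norm (torus_coeff \<phi> k) \<le> 4 ^ Suc 1 * C_norm (4 * 1) \<phi> * (1 / torus_weight k)" for k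
    using torus_coeff_decay[OF assms, of k 1] torus_weight_ge_1[of k]
    by (simp add: pos_le_divide_eq)
qed auto

section \<open>Uniqueness of Fourier coefficients\<close>

text \<open>The linear span of the characters. The inductive form replaces finite coefficient
  families by rule induction.\<close>

inductive trig_poly :: "(real \<times> real \<Rightarrow> complex) \<Rightarrow> bool" where
  trig_poly_char: "trig_poly (\<lambda>p. z * torus_char k p)"
| trig_poly_add: "trig_poly P \<Longrightarrow> trig_poly Q \<Longrightarrow> trig_poly (\<lambda>p. P p + Q p)"

lemma trig_poly_const: "trig_poly (\<lambda>p. z)"
  using trig_poly_char[of z 0] by simp

lemma trig_poly_char_mult: "trig_poly Q \<Longrightarrow> trig_poly (\<lambda>p. z * torus_char k p * Q p)"
proof (induction rule: trig_poly.induct)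
  case (trig_poly_char w j)
  then show ?case
    using trig_poly.trig_poly_char[of "z * w" "k + j"] by (simp add: torus_char_add mult_ac)
next
  case (trig_poly_add P Q)
  then show ?case
    using trig_poly.trig_poly_add by (fastforce simp: distrib_left)
qed

lemma trig_poly_mult: "trig_poly P \<Longrightarrow> trig_poly Q \<Longrightarrow> trig_poly (\<lambda>p. P p * Q p)"
proof (induction rule: trig_poly.induct)
  case (trig_poly_char w j)
  then show ?case by (simp add: trig_poly_char_mult)
next
  case (trig_poly_add P R)
  then show ?case
    using trig_poly.trig_poly_add by (fastforce simp: distrib_right)
qed

lemma trig_poly_cmult: "trig_poly P \<Longrightarrow> trig_poly (\<lambda>p. z * P p)"
  using trig_poly_mult[OF trig_poly_const] by simp

lemma trig_poly_continuous: "trig_poly P \<Longrightarrow> continuous_on S P"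
  by (induction rule: trig_poly.induct) (auto intro!: continuous_intros)

text \<open>The quotient map from the plane onto the product of two unit circles, the compact set on
  which Stone-Weierstrass is applied.\<close>

definition circle_pair :: "real \<times> real \<Rightarrow> complex \<times> complex" where
  "circle_pair p = (exp (\<i> * of_real (fst p)), exp (\<i> * of_real (snd p)))"

text \<open>A real-linear functional on pairs of complex numbers combines the real and imaginary
  parts of both coordinates, and Euler's formulas turn these into four characters. This is the base
  case for polynomials.\<close>

lemma trig_poly_circle_linear:
  assumes "bounded_linear (f :: complex \<times> complex \<Rightarrow> real)"
  shows "trig_poly (\<lambda>p. of_real (f (circle_pair p)))"
proof -
  interpret bounded_linear f by fact
  have f: "f (z, w) = Re z * f (1, 0) + Im z * f (\<i>, 0) + Re w * f (0, 1) + Im w * f (0, \<i>)" for z w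
  proof -
    have "(z, w) = Re z *\<^sub>R (1, 0) + Im z *\<^sub>R (\<i>, 0) + Re w *\<^sub>R (0, 1) + Im w *\<^sub>R (0, \<i>)"
      by (simp add: complex_eq_iff)
    then show ?thesis by (simp only: add scaleR real_scaleR_def)
  qed
  have re: "of_real (Re (exp (\<i> * of_real s))) = (exp (\<i> * of_real s) + exp (- (\<i> * of_real s))) / 2" for s :: real
    using complex_add_cnj[of "exp (\<i> * of_real s)"] by (simp add: exp_cnj)
  have im: "of_real (Im (exp (\<i> * of_real s))) = (exp (\<i> * of_real s) - exp (- (\<i> * of_real s))) * (- \<i> / 2)" for s :: real
  proof -
    have "exp (- (\<i> * of_real s)) = cnj (exp (\<i> * of_real s))" by (simp add: exp_cnj)
    then show ?thesis by (simp only: complex_diff_cnj) (simp add: complex_eq_iff)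
  qed
  have "of_real (f (circle_pair p)) =
      (of_real (f (1, 0)) / 2 - \<i> * of_real (f (\<i>, 0)) / 2) * torus_char (1, 0) p +
      ((of_real (f (1, 0)) / 2 + \<i> * of_real (f (\<i>, 0)) / 2) * torus_char (-1, 0) p +
      ((of_real (f (0, 1)) / 2 - \<i> * of_real (f (0, \<i>)) / 2) * torus_char (0, 1) p +
      (of_real (f (0, 1)) / 2 + \<i> * of_real (f (0, \<i>)) / 2) * torus_char (0, -1) p))" for p
  proof -
    have char: "torus_char (1, 0) p = exp (\<i> * of_real (fst p))" "torus_char (-1, 0) p = exp (- (\<i> * of_real (fst p)))"
      "torus_char (0, 1) p = exp (\<i> * of_real (snd p))" "torus_char (0, -1) p = exp (- (\<i> * of_real (snd p)))"
      by (simp_all add: torus_char_def)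
    show ?thesis
      unfolding circle_pair_def f[of "exp (\<i> * of_real (fst p))" "exp (\<i> * of_real (snd p))"]
        of_real_add of_real_mult re im char
      by (simp add: algebra_simps add_divide_distrib)
  qed
  then show ?thesis
    by (simp only:) (intro trig_poly_add trig_poly_char)
qed

lemma trig_poly_circle_real_polynomial:
  "real_polynomial_function f \<Longrightarrow> trig_poly (\<lambda>p. of_real (f (circle_pair p)))"
proof (induction rule: real_polynomial_function.induct)
  case (linear f) then show ?case by (rule trig_poly_circle_linear)
next
  case (const c) then show ?case by (rule trig_poly_const)
next
  case (add f g) then show ?case by (simp add: trig_poly_add)
next
  case (mult f g) then show ?case by (simp add: trig_poly_mult)
qed

lemma trig_poly_circle_polynomial:
  fixes g :: "complex \<times> complex \<Rightarrow> complex"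
  assumes "polynomial_function g"
  shows "trig_poly (\<lambda>p. g (circle_pair p))"
proof -
  have "real_polynomial_function (Re \<circ> g)" "real_polynomial_function (Im \<circ> g)"
    using assms bounded_linear_Re bounded_linear_Im unfolding polynomial_function_def by blast+
  then have "trig_poly (\<lambda>p. of_real (Re (g (circle_pair p))) + \<i> * of_real (Im (g (circle_pair p))))"
    using trig_poly_circle_real_polynomial by (intro trig_poly_add trig_poly_cmult) (auto simp: o_def)
  then show ?thesis by (simp flip: complex_eq)
qed

text \<open>Although \<^const>\<open>Arg2pi\<close> jumps, near a point \<open>z\<^sub>0\<close> of the circle it may be replaced, modulo \<open>2\<pi>\<close>, by
  \<open>Arg2pi z\<^sub>0 + Im (Ln (z / z\<^sub>0))\<close>, which is continuous there.\<close>
lemma continuous_on_torus_lift: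
  assumes per: "torus_periodic \<phi>" and cont: "continuous_on UNIV \<phi>"
  shows "continuous_on (sphere 0 1 \<times> sphere 0 1) (\<lambda>z. \<phi> (Arg2pi (fst z), Arg2pi (snd z)))"
  unfolding continuous_on_eq_continuous_within
proof
  fix z0 :: "complex \<times> complex"
  assume z0: "z0 \<in> sphere 0 1 \<times> sphere 0 1"
  then have nz: "fst z0 \<noteq> 0" "snd z0 \<noteq> 0" by auto
  have Arg: "exp (\<i> * of_real (Arg2pi z)) = z" if "z \<in> sphere 0 1" for z
    using Arg2pi[of z] that by (simp add: is_Arg_def)
  have Ln: "exp (\<i> * of_real (Arg2pi z + Im (Ln (w / z)))) = w" if "z \<in> sphere 0 1" "w \<in> sphere 0 1" for z w
  proof -
    from that have nz: "w / z \<noteq> 0" and n1: "norm (w / z) = 1" by (auto simp: norm_divide)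
    have "\<i> * of_real (Im (Ln (w / z))) = Ln (w / z)"
      using Re_Ln[OF nz] n1 by (simp add: complex_eq_iff)
    then have "exp (\<i> * of_real (Im (Ln (w / z)))) = w / z"
      using exp_Ln[OF nz] by simp
    then show ?thesis
      using Arg[OF that(1)] nz by (simp add: distrib_left exp_add)
  qed
  let ?l = "\<lambda>z. \<phi> (Arg2pi (fst z0) + Im (Ln (fst z / fst z0)), Arg2pi (snd z0) + Im (Ln (snd z / snd z0)))"
  have eq: "?l z = \<phi> (Arg2pi (fst z), Arg2pi (snd z))" if "z \<in> sphere 0 1 \<times> sphere 0 1" for z
    using that z0 by (intro torus_periodic_cong[OF per]) (auto simp only: Ln Arg mem_Times_iff)
  have "isCont Ln (fst z0 / fst z0)" "isCont Ln (snd z0 / snd z0)"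
    using nz by (auto intro!: continuous_at_Ln)
  then have "isCont (\<lambda>z. Ln (fst z / fst z0)) z0" "isCont (\<lambda>z. Ln (snd z / snd z0)) z0"
    using nz by (auto intro!: isCont_o2[where g = Ln] continuous_intros)
  then have "isCont (\<lambda>z. (Arg2pi (fst z0) + Im (Ln (fst z / fst z0)), Arg2pi (snd z0) + Im (Ln (snd z / snd z0)))) z0"
    by (intro continuous_Pair continuous_add continuous_const isCont_Im)
  moreover have "isCont \<phi> p" for p
    using cont continuous_on_eq_continuous_at[of UNIV \<phi>] by blast
  ultimately have "isCont ?l z0"
    by (rule isCont_o2)
  then have "continuous (at z0 within sphere 0 1 \<times> sphere 0 1) ?l"
    by (rule continuous_at_imp_continuous_within)
  then show "continuous (at z0 within sphere 0 1 \<times> sphere 0 1) (\<lambda>z. \<phi> (Arg2pi (fst z), Arg2pi (snd z)))"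
    by (rule continuous_transform_within[where \<delta> = 1]) (use z0 eq in auto)
qed

text \<open>The lift of \<phi> to the product of circles is approximated by a polynomial, whose
  pullback along \<open>circle_pair\<close> is a trigonometric polynomial.\<close>

lemma trig_poly_dense:
  assumes "torus_periodic \<phi>" "continuous_on UNIV \<phi>" "0 < e"
  obtains P where "trig_poly P" "\<And>p. norm (\<phi> p - P p) < e"
proof -
  have "compact (sphere 0 1 \<times> sphere 0 1 :: (complex \<times> complex) set)"
    by (intro compact_Times compact_sphere)
  from Stone_Weierstrass_polynomial_function[OF this continuous_on_torus_lift[OF assms(1,2)] assms(3)]
  obtain g where g: "polynomial_function g"
    "\<And>z. z \<in> sphere 0 1 \<times> sphere 0 1 \<Longrightarrow> norm (\<phi> (Arg2pi (fst z), Arg2pi (snd z)) - g z) < e"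
    by blast
  have "norm (\<phi> p - g (circle_pair p)) < e" for p
  proof -
    have "\<phi> (Arg2pi (fst (circle_pair p)), Arg2pi (snd (circle_pair p))) = \<phi> (fst p, snd p)"
      using Arg2pi[of "fst (circle_pair p)"] Arg2pi[of "snd (circle_pair p)"]
      by (intro torus_periodic_cong[OF assms(1)]) (simp_all add: circle_pair_def is_Arg_def)
    then show ?thesis
      using g(2)[of "circle_pair p"] by (simp add: circle_pair_def)
  qed
  then show thesis
    using that trig_poly_circle_polynomial[OF g(1)] by blast
qed

text \<open>By linearity \<open>h\<close> integrates to zero against every trigonometric polynomial.
  Approximating the conjugate of \<open>h\<close> by such polynomials shows that the integral of
  |h|^2 vanishes.\<close>

lemma torus_coeff_eq_0_imp_eq_0:
  assumes per: "torus_periodic h" and cont: "continuous_on UNIV h" and zero: "\<And>k. torus_coeff h k = 0"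
  shows "h p = 0"
proof -
  have ann: "integral torus_box (\<lambda>p. h p * P p) = 0" if "trig_poly P" for P
    using that
  proof induction
    case (trig_poly_char z k)
    have "integral torus_box (\<lambda>p. h p * torus_char k p) = 0"
      using zero[of "- k"] by (simp add: torus_coeff_def)
    moreover have "(\<lambda>p. h p * (z * torus_char k p)) = (\<lambda>p. z * (h p * torus_char k p))"
      by (simp add: mult_ac)
    ultimately show ?case by simp
  next
    case (trig_poly_add P Q)
    have "(\<lambda>p. h p * P p) integrable_on torus_box" "(\<lambda>p. h p * Q p) integrable_on torus_box"
      by (intro integrable_torus_box continuous_on_mult cont trig_poly_continuous trig_poly_add)+
    with trig_poly_add show ?case by (simp add: distrib_left integral_add)
  qed
  have "bounded (h ` torus_box)"
    by (intro compact_imp_bounded compact_continuous_image continuous_on_subset[OF cont] compact_cbox) auto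
  then obtain B where "B > 0" and B: "\<And>p. norm (h p) \<le> B"
    using torus_periodic_box[OF per] unfolding bounded_pos by (metis imageI)
  let ?N = "norm (integral torus_box (\<lambda>p. h p * cnj (h p)))"
  have "?N \<le> 0 + e" if "e > 0" for e
  proof -
    \<comment> \<open>Chosen so that the sup bound \<open>B * d\<close>, multiplied by the area of
      the box, is exactly \<open>e\<close>.\<close>
    define d where "d = e / (B * (2 * pi)\<^sup>2)"
    have "d > 0" using that \<open>B > 0\<close> by (simp add: d_def)
    have "torus_periodic (\<lambda>p. cnj (h p))" using per by (simp add: torus_periodic_def)
    moreover have cnj: "continuous_on UNIV (\<lambda>p. cnj (h p))" by (intro continuous_intros cont)
    ultimately obtain P where P: "trig_poly P" "\<And>p. norm (cnj (h p) - P p) < d"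
      using trig_poly_dense \<open>d > 0\<close> by blast
    have int: "(\<lambda>p. h p * cnj (h p)) integrable_on torus_box" "(\<lambda>p. h p * P p) integrable_on torus_box"
      by (intro integrable_torus_box continuous_on_mult cont cnj trig_poly_continuous[OF P(1)])+
    have "integral torus_box (\<lambda>p. h p * cnj (h p)) = integral torus_box (\<lambda>p. h p * (cnj (h p) - P p))"
      using integral_diff[OF int(1,2)] by (simp add: right_diff_distrib ann[OF P(1)])
    also have "norm \<dots> \<le> (B * d) * (2 * pi)\<^sup>2"
    proof (rule norm_integral_torus_box_le)
      show "continuous_on UNIV (\<lambda>p. h p * (cnj (h p) - P p))"
        by (intro continuous_on_mult continuous_on_diff cont cnj trig_poly_continuous[OF P(1)])
      show "norm (h p * (cnj (h p) - P p)) \<le> B * d" for p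
        unfolding norm_mult using B P(2) \<open>B > 0\<close> by (intro mult_mono less_imp_le[OF P(2)]) auto
    qed
    also have "\<dots> = e" using \<open>B > 0\<close> by (simp add: d_def)
    finally show ?thesis by simp
  qed
  then have "?N \<le> 0" by (rule field_le_epsilon)
  then have "integral torus_box (\<lambda>p. complex_of_real ((norm (h p))\<^sup>2)) = 0"
    by (simp only: complex_norm_square) simp
  moreover have sq: "continuous_on UNIV (\<lambda>p. (norm (h p))\<^sup>2)" by (intro continuous_intros cont)
  then have "((\<lambda>p. complex_of_real ((norm (h p))\<^sup>2)) has_integral
      of_real (integral torus_box (\<lambda>p. (norm (h p))\<^sup>2))) torus_box"
    by (rule has_integral_of_real[OF integrable_integral[OF integrable_torus_box]])
  from integral_unique[OF this] calculation have "integral torus_box (\<lambda>p. (norm (h p))\<^sup>2) = 0"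
    by (metis of_real_eq_0_iff)
  \<comment> \<open>A nonempty interior is what allows a vanishing integral of a continuous
    nonnegative function to force the function to vanish on the box.\<close>
  moreover have "box (0, 0) (2 * pi, 2 * pi) \<noteq> ({} :: (real \<times> real) set)"
    by (auto simp: box_ne_empty Basis_prod_def)
  ultimately have "\<forall>q\<in>torus_box. (norm (h q))\<^sup>2 = 0"
    using integral_cbox_eq_0_iff[OF continuous_on_subset[OF sq subset_UNIV]] by simp
  moreover obtain q where "q \<in> torus_box" "h q = h p"
    using torus_periodic_box[OF per] by blast
  ultimately show ?thesis by (metis norm_eq_zero zero_eq_power2)
qed

section \<open>Fourier expansion of test functions and distributions\<close>

text \<open>The Weierstrass M-test with the absolutely summable coefficients as majorants. That the
  limit is \<phi> itself is only established in \<open>fourier_inversion\<close>.\<close>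

lemma fourier_sum_uniform_limit_infsum:
  assumes "\<phi> \<in> test_functions"
  shows "uniform_limit UNIV (\<lambda>F. fourier_sum F \<phi>) (\<lambda>p. \<Sum>\<^sub>\<infinity>k. torus_coeff \<phi> k * torus_char k p)
    (finite_subsets_at_top UNIV)"
  unfolding fourier_sum_def[abs_def]
  by (rule Weierstrass_m_test_general[where M = "\<lambda>k. norm (torus_coeff \<phi> k)"])
     (auto simp: norm_mult torus_coeff_abs_summable[OF assms])

lemma torus_coeff_diff:
  assumes "continuous_on UNIV \<phi>" "continuous_on UNIV \<psi>"
  shows "torus_coeff (\<lambda>p. \<phi> p - \<psi> p) k = torus_coeff \<phi> k - torus_coeff \<psi> k"
  using torus_coeff_add[OF assms(1) continuous_on_mult_left[OF assms(2), of "-1"]] torus_coeff_cmult[of "-1" \<psi> k]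
  by simp

lemma continuous_on_fourier_sum: "continuous_on S (fourier_sum F \<phi>)"
  unfolding fourier_sum_def[abs_def] by (intro continuous_intros)

lemma torus_coeff_fourier_sum:
  assumes "finite F"
  shows "torus_coeff (fourier_sum F \<phi>) k = (if k \<in> F then torus_coeff \<phi> k else 0)"
proof -
  have "torus_coeff (fourier_sum F \<phi>) k = (\<Sum>j\<in>F. torus_coeff \<phi> j * torus_coeff (torus_char j) k)"
    using assms
  proof (induction F rule: finite_induct)
    case empty
    then show ?case by (simp add: fourier_sum_def[abs_def] torus_coeff_def)
  next
    case (insert j F)
    have "fourier_sum (insert j F) \<phi> = (\<lambda>p. torus_coeff \<phi> j * torus_char j p + fourier_sum F \<phi> p)"
      using insert by (simp add: fourier_sum_def[abs_def])
    moreover have "continuous_on UNIV (\<lambda>p. torus_coeff \<phi> j * torus_char j p)"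
      by (intro continuous_intros)
    ultimately show ?case
      using insert by (simp add: torus_coeff_add[OF _ continuous_on_fourier_sum] torus_coeff_cmult)
  qed
  then show ?thesis
    using assms by (simp add: torus_coeff_char if_distrib cong: if_cong)
qed

text \<open>The sum of the series is continuous, periodic and has the same coefficients as \<phi>,
  so the difference falls under \<open>torus_coeff_eq_0_imp_eq_0\<close>.\<close>

theorem fourier_inversion:
  assumes \<phi>: "\<phi> \<in> test_functions"
  shows "(\<Sum>\<^sub>\<infinity>k. torus_coeff \<phi> k * torus_char k p) = \<phi> p"
proof -
  let ?A = "finite_subsets_at_top (UNIV :: (int \<times> int) set)"
  define g where "g p = (\<Sum>\<^sub>\<infinity>k. torus_coeff \<phi> k * torus_char k p)" for p
  have lim: "uniform_limit UNIV (\<lambda>F. fourier_sum F \<phi>) g ?A"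
    using fourier_sum_uniform_limit_infsum[OF \<phi>] by (simp add: g_def[abs_def])
  have contg: "continuous_on UNIV g"
    by (rule uniform_limit_theorem[OF _ lim]) (auto simp: continuous_on_fourier_sum)
  have "torus_periodic g"
    using torus_periodic_char unfolding g_def torus_periodic_def by simp
  then have per: "torus_periodic (\<lambda>p. \<phi> p - g p)"
    using test_functions_periodic[OF \<phi>] by (simp add: torus_periodic_def)
  have cont: "continuous_on UNIV (\<lambda>p. \<phi> p - g p)"
    by (intro continuous_on_diff contg test_functions_continuous \<phi>)
  have "torus_coeff (\<lambda>p. \<phi> p - g p) k = 0" for k
  proof -
    have "norm (torus_coeff (\<lambda>p. \<phi> p - g p) k) \<le> 0 + e" if "e > 0" for e
    proof -
      obtain X where X: "finite X"
        "\<And>Y. finite Y \<Longrightarrow> X \<subseteq> Y \<Longrightarrow> \<forall>p. dist (fourier_sum Y \<phi> p) (g p) < e"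
        using uniform_limitD[OF lim \<open>e > 0\<close>] unfolding eventually_finite_subsets_at_top by auto
      \<comment> \<open>Once \<open>F\<close> contains \<open>k\<close>, the partial sum over
        \<open>F\<close> has the same \<open>k\<close>-th coefficient as \<phi>; uniform closeness
        to \<open>g\<close> then makes the coefficient of the difference small.\<close>
      define F where "F = insert k X"
      have F: "\<And>p. dist (fourier_sum F \<phi> p) (g p) < e" "finite F" "k \<in> F"
        using X(1) X(2)[of F] unfolding F_def by blast+
      have "torus_coeff (\<lambda>p. \<phi> p - g p) k = torus_coeff (\<lambda>p. fourier_sum F \<phi> p - g p) k"
        using F by (simp add: torus_coeff_diff contg continuous_on_fourier_sum test_functions_continuous \<phi> torus_coeff_fourier_sum)
      also have "norm \<dots> \<le> e"
        using F(1) by (intro norm_torus_coeff_le continuous_on_diff contg continuous_on_fourier_sum)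
          (simp add: dist_norm less_imp_le)
      finally show ?thesis by simp
    qed
    then have "norm (torus_coeff (\<lambda>p. \<phi> p - g p) k) \<le> 0" by (rule field_le_epsilon)
    then show ?thesis by simp
  qed
  from torus_coeff_eq_0_imp_eq_0[OF per cont this, of p] show ?thesis
    by (simp add: g_def)
qed

lemma fourier_sum_uniform_limit:
  assumes "\<phi> \<in> test_functions"
  shows "uniform_limit UNIV (\<lambda>F. fourier_sum F \<phi>) \<phi> (finite_subsets_at_top UNIV)"
  using fourier_sum_uniform_limit_infsum[OF assms] by (simp add: fourier_inversion[OF assms])

lemma SUP_fourier_remainder_tendsto_0:
  assumes "\<phi> \<in> test_functions"
  shows "((\<lambda>F. SUP p. norm (\<phi> p - fourier_sum F \<phi> p)) \<longlongrightarrow> 0) (finite_subsets_at_top UNIV)"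
proof (rule tendstoI)
  fix e :: real assume "e > 0"
  \<comment> \<open>Pointwise strict bounds pass to the supremum only as a weak one, hence
    \<open>e / 2\<close>.\<close>
  then have "\<forall>\<^sub>F F in finite_subsets_at_top UNIV. (\<forall>p\<in>UNIV. dist (fourier_sum F \<phi> p) (\<phi> p) < e / 2) \<and> finite F"
    by (intro eventually_conj uniform_limitD fourier_sum_uniform_limit assms eventually_finite_subsets_at_top_weakI) auto
  then show "\<forall>\<^sub>F F in finite_subsets_at_top UNIV. dist (SUP p. norm (\<phi> p - fourier_sum F \<phi> p)) 0 < e"
  proof eventually_elim
    case (elim F)
    then have "dist (fourier_sum F \<phi> p) (\<phi> p) < e / 2" for p
      by blast
    then have "norm (\<phi> p - fourier_sum F \<phi> p) \<le> e / 2" for p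
      by (simp add: dist_norm norm_minus_commute less_imp_le)
    then have "(SUP p. norm (\<phi> p - fourier_sum F \<phi> p)) \<le> e / 2"
      by (intro cSUP_least) auto
    moreover have "0 \<le> (SUP p. norm (\<phi> p - fourier_sum F \<phi> p))"
      using norm_le_SUP_test[OF test_functions_diff[OF assms fourier_sum_test[of F \<phi>]], of 0] elim
      by (meson norm_ge_zero order_trans)
    ultimately show ?case using \<open>e > 0\<close> by simp
  qed
qed

text \<open>Differentiating a partial sum and differentiating \<phi> multiply coefficients by the
  same factors. A derivative of the remainder is therefore the remainder of the derivative, and
  uniform convergence upgrades to every \<open>C_norm\<close>.\<close>

lemma partial_iter_fourier_remainder:
  assumes "\<phi> \<in> test_functions"
  shows "(partial_t ^^ m) ((partial_x ^^ n) (\<lambda>p. \<phi> p - fourier_sum F \<phi> p)) =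
    (\<lambda>p. (partial_t ^^ m) ((partial_x ^^ n) \<phi>) p - fourier_sum F ((partial_t ^^ m) ((partial_x ^^ n) \<phi>)) p)"
proof -
  have t: "partial_t (\<lambda>p. \<psi> p - fourier_sum F \<psi> p) = (\<lambda>p. partial_t \<psi> p - fourier_sum F (partial_t \<psi>) p)"
    and x: "partial_x (\<lambda>p. \<psi> p - fourier_sum F \<psi> p) = (\<lambda>p. partial_x \<psi> p - fourier_sum F (partial_x \<psi>) p)"
    if "\<psi> \<in> test_functions" for \<psi>
    unfolding partial_fourier_remainder[OF that]
    by (simp_all add: fourier_sum_def torus_coeff_partial[OF that])
  have "(partial_x ^^ n) (\<lambda>p. \<phi> p - fourier_sum F \<phi> p) =
    (\<lambda>p. (partial_x ^^ n) \<phi> p - fourier_sum F ((partial_x ^^ n) \<phi>) p)"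
    using partial_iter_test[OF assms, of 0] by (induction n) (simp_all add: x)
  then show ?thesis
    using partial_iter_test[OF assms, of _ n] by (induction m) (simp_all add: t)
qed

lemma C_norm_fourier_remainder_tendsto_0:
  assumes "\<phi> \<in> test_functions"
  shows "((\<lambda>F. C_norm N (\<lambda>p. \<phi> p - fourier_sum F \<phi> p)) \<longlongrightarrow> 0) (finite_subsets_at_top UNIV)"
  unfolding C_norm_def partial_iter_fourier_remainder[OF assms]
  by (rule tendsto_null_sum)
     (auto intro!: SUP_fourier_remainder_tendsto_0 partial_iter_test assms)

section \<open>Distributions and coefficient families\<close>

context
  fixes u assumes u: "u \<in> distributions"
begin

lemma distributions_add: "\<phi> \<in> test_functions \<Longrightarrow> \<psi> \<in> test_functions \<Longrightarrow> u (\<lambda>p. \<phi> p + \<psi> p) = u \<phi> + u \<psi>"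
  and distributions_cmult: "\<phi> \<in> test_functions \<Longrightarrow> u (\<lambda>p. z * \<phi> p) = z * u \<phi>"
  using u unfolding distributions_def by blast+

lemma distributions_diff:
  "\<phi> \<in> test_functions \<Longrightarrow> \<psi> \<in> test_functions \<Longrightarrow> u (\<lambda>p. \<phi> p - \<psi> p) = u \<phi> - u \<psi>"
  using distributions_add[of \<phi> "\<lambda>p. -1 * \<psi> p"] distributions_cmult[of \<psi> "-1"] test_functions_cmult[of \<psi> "-1"]
  by simp

lemma distributions_fourier_sum:
  "finite F \<Longrightarrow> u (fourier_sum F \<phi>) = (\<Sum>k\<in>F. torus_coeff \<phi> k * u (torus_char k))"
proof (induction F rule: finite_induct)
  case empty
  then show ?case
    using distributions_cmult[OF torus_char_test, of 0] by (simp add: fourier_sum_def[abs_def])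
next
  case (insert j F)
  have "fourier_sum (insert j F) \<phi> = (\<lambda>p. torus_coeff \<phi> j * torus_char j p + fourier_sum F \<phi> p)"
    using insert by (simp add: fourier_sum_def[abs_def])
  with insert show ?case
    by (simp add: distributions_add distributions_cmult test_functions_cmult torus_char_test fourier_sum_test)
qed

text \<open>Linearity evaluates \<open>u\<close> on partial sums, and continuity in some
  \<open>C_norm N\<close> lets the remainder tend to zero. In particular, the values on characters
  determine \<open>u\<close>.\<close>

theorem distributions_expansion:
  assumes \<phi>: "\<phi> \<in> test_functions"
  shows "((\<lambda>k. torus_coeff \<phi> k * u (torus_char k)) has_sum u \<phi>) UNIV"
proof -
  from u obtain N C where C: "\<And>\<phi>. \<phi> \<in> test_functions \<Longrightarrow> norm (u \<phi>) \<le> C * C_norm N \<phi>"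
    unfolding distributions_def by blast
  have "((\<lambda>F. u \<phi> - (\<Sum>k\<in>F. torus_coeff \<phi> k * u (torus_char k))) \<longlongrightarrow> 0) (finite_subsets_at_top UNIV)"
  proof (rule Lim_null_comparison)
    show "((\<lambda>F. C * C_norm N (\<lambda>p. \<phi> p - fourier_sum F \<phi> p)) \<longlongrightarrow> 0) (finite_subsets_at_top UNIV)"
      by (intro tendsto_mult_right_zero C_norm_fourier_remainder_tendsto_0 \<phi>)
    show "\<forall>\<^sub>F F in finite_subsets_at_top UNIV. norm (u \<phi> - (\<Sum>k\<in>F. torus_coeff \<phi> k * u (torus_char k)))
        \<le> C * C_norm N (\<lambda>p. \<phi> p - fourier_sum F \<phi> p)"
    proof (rule eventually_finite_subsets_at_top_weakI)
      fix F :: "(int \<times> int) set" assume "finite F"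
      then show "norm (u \<phi> - (\<Sum>k\<in>F. torus_coeff \<phi> k * u (torus_char k)))
        \<le> C * C_norm N (\<lambda>p. \<phi> p - fourier_sum F \<phi> p)"
        using C[OF test_functions_diff[OF \<phi> fourier_sum_test[of F \<phi>]]] \<phi>
        by (simp add: distributions_diff fourier_sum_test distributions_fourier_sum)
    qed
  qed
  then have "((\<lambda>F. - (u \<phi> - (\<Sum>k\<in>F. torus_coeff \<phi> k * u (torus_char k))) + u \<phi>) \<longlongrightarrow> - 0 + u \<phi>)
      (finite_subsets_at_top UNIV)"
    by (intro tendsto_intros)
  then show ?thesis by (simp add: has_sum_def)
qed

end

text \<open>The functional is the pairing with the coefficients of the test function, whose rapid
  decay beats the polynomial growth of \<open>U\<close>.\<close>

lemma distribution_of_coefficients: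
  assumes U: "\<And>k. norm (U k) \<le> C * torus_weight k ^ M"
  obtains u where "u \<in> distributions" "\<And>k. u (torus_char k) = U k"
proof
  define u where "u = (\<lambda>\<phi>\<in>test_functions. \<Sum>\<^sub>\<infinity>k. torus_coeff \<phi> k * U k)"
  define W where "W = (\<Sum>\<^sub>\<infinity>k. 1 / torus_weight k)"
  \<comment> \<open>The weight equals 1 at frequency zero, so the growth bound there forces
    \<open>C\<close> to be nonnegative.\<close>
  have "0 \<le> norm (U 0)" by simp
  also have "\<dots> \<le> C" using U[of 0] by (simp add: torus_weight_def)
  finally have "0 \<le> C" .
  \<comment> \<open>Decay with exponent \<open>Suc M\<close> cancels the growth of \<open>U\<close>
    and leaves one reciprocal weight for summability. The same estimate gives continuity in the norm
    of order \<open>4 * Suc M\<close>.\<close>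
  have bound: "norm (torus_coeff \<phi> k * U k) \<le> C * 4 ^ Suc (Suc M) * C_norm (4 * Suc M) \<phi> * (1 / torus_weight k)"
    if "\<phi> \<in> test_functions" for \<phi> k
  proof -
    have w: "torus_weight k > 0" using torus_weight_ge_1[of k] by linarith
    have "norm (torus_coeff \<phi> k * U k) \<le> norm (torus_coeff \<phi> k) * (C * torus_weight k ^ M)"
      unfolding norm_mult by (intro mult_left_mono U) auto
    also have "\<dots> = C * (norm (torus_coeff \<phi> k) * torus_weight k ^ Suc M) * (1 / torus_weight k)"
      using w by simp
    also have "\<dots> \<le> C * (4 ^ Suc (Suc M) * C_norm (4 * Suc M) \<phi>) * (1 / torus_weight k)"
      using w \<open>0 \<le> C\<close> by (intro mult_right_mono mult_left_mono torus_coeff_decay that) auto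
    finally show ?thesis by (simp only: mult.assoc)
  qed
  have bound_has_sum: "((\<lambda>k. z * (1 / torus_weight k)) has_sum z * W) UNIV" for z
    unfolding W_def by (intro has_sum_cmult_right has_sum_infsum summable_inverse_torus_weight)
  have sum: "(\<lambda>k. torus_coeff \<phi> k * U k) summable_on UNIV" if "\<phi> \<in> test_functions" for \<phi>
  proof (rule abs_summable_summable, rule summable_on_comparison_test)
    show "(\<lambda>k. C * 4 ^ Suc (Suc M) * C_norm (4 * Suc M) \<phi> * (1 / torus_weight k)) summable_on UNIV"
      using bound_has_sum by (rule has_sum_imp_summable)
  qed (use bound[OF that] in auto)
  show "u \<in> distributions"
    unfolding distributions_def
  proof (intro CollectI conjI ballI allI)
    show "u \<in> extensional test_functions" by (simp add: u_def)
    show "u (\<lambda>p. \<phi> p + \<psi> p) = u \<phi> + u \<psi>" if "\<phi> \<in> test_functions" "\<psi> \<in> test_functions" for \<phi> \<psi>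
      using that sum
      by (simp add: u_def test_functions_add torus_coeff_add test_functions_continuous distrib_right infsum_add)
    show "u (\<lambda>p. z * \<phi> p) = z * u \<phi>" if "\<phi> \<in> test_functions" for \<phi> z
      using that by (simp add: u_def test_functions_cmult torus_coeff_cmult mult.assoc infsum_cmult_right')
    have "norm (u \<phi>) \<le> (C * 4 ^ Suc (Suc M) * W) * C_norm (4 * Suc M) \<phi>" if "\<phi> \<in> test_functions" for \<phi>
    proof -
      have "norm (u \<phi>) \<le> C * 4 ^ Suc (Suc M) * C_norm (4 * Suc M) \<phi> * W"
        using norm_infsum_le[OF has_sum_infsum[OF sum[OF that]] bound_has_sum bound[OF that]] that
        by (simp only: u_def restrict_apply if_True)
      then show ?thesis by (simp only: mult_ac)
    qed
    then show "\<exists>N C. \<forall>\<phi>\<in>test_functions. norm (u \<phi>) \<le> C * C_norm N \<phi>" by blast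
  qed
  show "u (torus_char k) = U k" for k
  proof -
    have "u (torus_char k) = (\<Sum>\<^sub>\<infinity>j. (if k = j then 1 else 0) * U j)"
      by (simp add: u_def torus_char_test torus_coeff_char)
    also have "\<dots> = (\<Sum>\<^sub>\<infinity>j\<in>{k}. U j)"
      by (rule infsum_cong_neutral) auto
    finally show ?thesis by simp
  qed
qed

section \<open>The operator as a Fourier multiplier\<close>

lemma jbracket_sqrt: "jbracket w = sqrt (1 + w\<^sup>2)"
  unfolding jbracket_def by (subst powr_half_sqrt) auto

lemma jbracket_ge_1: "1 \<le> jbracket w"
  by (simp add: jbracket_sqrt)

lemma jbracket_pos: "0 < jbracket w"
  using jbracket_ge_1[of w] by linarith

lemma jbracket_minus [simp]: "jbracket (- w) = jbracket w"
  by (simp add: jbracket_sqrt)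

lemma jbracket_square: "(jbracket w)\<^sup>2 = 1 + w\<^sup>2"
  by (simp add: jbracket_sqrt)

lemma abs_le_jbracket: "\<bar>w\<bar> \<le> jbracket w"
  unfolding jbracket_sqrt by (rule real_le_rsqrt) simp

lemma jbracket_le_1_plus_abs: "jbracket w \<le> 1 + \<bar>w\<bar>"
  unfolding jbracket_sqrt by (rule real_le_lsqrt) (auto simp: power2_eq_square algebra_simps)

lemma jbracket_powr_le:
  assumes "s \<le> of_nat M"
  shows "jbracket w powr s \<le> (1 + w\<^sup>2) ^ M"
proof -
  have "jbracket w powr s \<le> jbracket w powr of_nat M"
    using assms jbracket_ge_1 by (rule powr_mono)
  also have "\<dots> = jbracket w ^ M"
    by (rule powr_realpow[OF jbracket_pos])
  also have "\<dots> \<le> ((jbracket w)\<^sup>2) ^ M"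
    using jbracket_ge_1[of w] by (intro power_mono) (auto simp: power2_eq_square)
  finally show ?thesis by (simp add: jbracket_square)
qed

text \<open>The pairing is bilinear, so a coefficient is a value on the character of opposite
  frequency. This is the source of the sign changes between the two descriptions.\<close>

lemma fourier_coeff_torus_char:
  "fourier_coeff u \<tau> \<xi> = u (torus_char (- \<tau>, - \<xi>)) / of_real ((2 * pi)\<^sup>2)"
proof -
  have "(\<lambda>(t, x). exp (- (\<i> * of_real (t * of_int \<tau> + x * of_int \<xi>)))) = torus_char (- \<tau>, - \<xi>)"
    by (auto simp: torus_char_def algebra_simps)
  then show ?thesis by (simp add: fourier_coeff_def)
qed

lemma L_op_apply:
  "\<phi> \<in> test_functions \<Longrightarrow> L_op c u \<phi> = c * u (partial_x \<phi>) - u (partial_t \<phi>)"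
  by (simp add: L_op_def dist_partial_t_def dist_partial_x_def)

text \<open>At \<open>k = (- \<tau>, - \<xi>)\<close> the factor is \<i> * (\<tau> - c * \<xi>), the
  symbol of the operator.\<close>

lemma L_op_torus_char:
  assumes "u \<in> distributions"
  shows "L_op c u (torus_char k) = \<i> * (c * of_int (snd k) - of_int (fst k)) * u (torus_char k)"
  unfolding L_op_apply[OF torus_char_test] partial_torus_char distributions_cmult[OF assms torus_char_test]
  by (simp add: algebra_simps)

text \<open>Expanding \<open>u\<close> on both partial derivatives of a test function moves the
  symbol from the test coefficients to \<open>u\<close>, which reproduces the expansion of
  \<open>f\<close>.\<close>

theorem L_op_eq_iff:
  assumes u: "u \<in> distributions" and f: "f \<in> distributions"
  shows "L_op c u = f \<longleftrightarrow>
    (\<forall>k. \<i> * (c * of_int (snd k) - of_int (fst k)) * u (torus_char k) = f (torus_char k))"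
proof
  assume "L_op c u = f"
  then show "\<forall>k. \<i> * (c * of_int (snd k) - of_int (fst k)) * u (torus_char k) = f (torus_char k)"
    using L_op_torus_char[OF u] by metis
next
  assume *: "\<forall>k. \<i> * (c * of_int (snd k) - of_int (fst k)) * u (torus_char k) = f (torus_char k)"
  show "L_op c u = f"
  proof
    fix \<phi>
    show "L_op c u \<phi> = f \<phi>"
    proof (cases "\<phi> \<in> test_functions")
      case False
      \<comment> \<open>Off the test functions both sides have the default value
        \<open>undefined\<close>.\<close>
      have "f \<in> extensional test_functions" using f by (simp add: distributions_def)
      with False show ?thesis by (simp add: L_op_def extensional_def)
    next
      case \<phi>: True
      have "((\<lambda>k. torus_coeff (partial_x \<phi>) k * u (torus_char k)) has_sum u (partial_x \<phi>)) UNIV"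
        "((\<lambda>k. torus_coeff (partial_t \<phi>) k * u (torus_char k)) has_sum u (partial_t \<phi>)) UNIV"
        by (intro distributions_expansion[OF u] partial_x_test partial_t_test \<phi>)+
      then have "((\<lambda>k. c * (torus_coeff (partial_x \<phi>) k * u (torus_char k))
          + - (torus_coeff (partial_t \<phi>) k * u (torus_char k))) has_sum
          (c * u (partial_x \<phi>) + - u (partial_t \<phi>))) UNIV"
        by (intro has_sum_add has_sum_cmult_right has_sum_uminusI)
      moreover have "c * (torus_coeff (partial_x \<phi>) k * u (torus_char k))
          + - (torus_coeff (partial_t \<phi>) k * u (torus_char k)) = torus_coeff \<phi> k * f (torus_char k)" for k
        unfolding torus_coeff_partial[OF \<phi>] *[rule_format, of k, symmetric] by (simp add: algebra_simps)
      ultimately have "((\<lambda>k. torus_coeff \<phi> k * f (torus_char k)) has_sum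
          (c * u (partial_x \<phi>) + - u (partial_t \<phi>))) UNIV"
        by simp
      from has_sum_unique[OF this distributions_expansion[OF f \<phi>]] show ?thesis
        by (simp add: L_op_apply[OF \<phi>])
    qed
  qed
qed

lemma distributions_eqI:
  assumes "u \<in> distributions" "v \<in> distributions" "\<And>k. u (torus_char k) = v (torus_char k)"
  shows "u = v"
proof
  fix \<phi>
  show "u \<phi> = v \<phi>"
  proof (cases "\<phi> \<in> test_functions")
    case True
    then show ?thesis
      using distributions_expansion[OF assms(1) True] distributions_expansion[OF assms(2) True]
      by (simp add: assms(3) has_sum_unique)
  next
    case False
    moreover have "u \<in> extensional test_functions" "v \<in> extensional test_functions"
      using assms by (simp_all add: distributions_def)
    ultimately show ?thesis by (simp add: extensional_def)
  qed
qed

section \<open>Mixed Sobolev regularity on the Fourier side\<close>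

text \<open>Stated for an arbitrary family \<open>g\<close>, because the coefficients of a solution
  are estimated before they are known to come from a distribution.\<close>

definition mix_term :: "real \<Rightarrow> real \<Rightarrow> (int \<Rightarrow> int \<Rightarrow> complex) \<Rightarrow> int \<times> int \<Rightarrow> real" where
  "mix_term s1 s2 g = (\<lambda>(\<tau>, \<xi>). jbracket (of_int \<tau>) powr (2 * s1) * jbracket (of_int \<xi>) powr (2 * s2) *
     (norm (g \<tau> \<xi>))\<^sup>2)"

lemma H_mix_iff: "f \<in> H_mix s1 s2 \<longleftrightarrow> f \<in> distributions \<and> mix_term s1 s2 (fourier_coeff f) summable_on UNIV"
  by (simp add: H_mix_def mix_term_def)

lemma mix_term_eq_square:
  "mix_term s1 s2 g (\<tau>, \<xi>) = (jbracket (of_int \<tau>) powr s1 * jbracket (of_int \<xi>) powr s2 * norm (g \<tau> \<xi>))\<^sup>2"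
proof -
  have "w powr (2 * s) = (w powr s)\<^sup>2" for w s :: real
    unfolding mult_2 powr_add power2_eq_square by (rule refl)
  then show ?thesis by (simp only: mix_term_def power_mult_distrib prod.case)
qed

text \<open>Each nonnegative term is at most the whole sum; taking square roots and moving the
  weights to the other side leaves a power of \<open>torus_weight\<close>.\<close>

lemma mix_term_summable_imp_poly_bound:
  assumes "mix_term s1 s2 g summable_on UNIV"
  obtains C M where "\<And>\<tau> \<xi>. norm (g \<tau> \<xi>) \<le> C * torus_weight (\<tau>, \<xi>) ^ M"
proof -
  define S where "S = infsum (mix_term s1 s2 g) UNIV"
  \<comment> \<open>Dominates both orders with reversed sign; \<open>nat\<close> rounds negative
    values up to 0, which keeps the two bounds.\<close>
  define M where "M = nat \<lceil>max (- s1) (- s2)\<rceil>"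
  have M: "- s1 \<le> of_nat M" "- s2 \<le> of_nat M" unfolding M_def by linarith+
  have nonneg: "0 \<le> mix_term s1 s2 g k" for k
    by (cases k) (simp add: mix_term_eq_square)
  have S: "0 \<le> S" unfolding S_def by (intro infsum_nonneg nonneg)
  have "norm (g \<tau> \<xi>) \<le> sqrt S * torus_weight (\<tau>, \<xi>) ^ M" for \<tau> \<xi>
  proof -
    let ?T = "jbracket (of_int \<tau>)" and ?X = "jbracket (of_int \<xi>)"
    have "mix_term s1 s2 g (\<tau>, \<xi>) \<le> S"
      using finite_sum_le_infsum[OF assms, of "{(\<tau>, \<xi>)}"] nonneg by (simp add: S_def)
    then have "?T powr s1 * ?X powr s2 * norm (g \<tau> \<xi>) \<le> sqrt S"
      unfolding mix_term_eq_square by (rule real_le_rsqrt)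
    then have "(?T powr s1 * ?X powr s2 * norm (g \<tau> \<xi>)) * (?T powr (- s1) * ?X powr (- s2))
        \<le> sqrt S * (?T powr (- s1) * ?X powr (- s2))"
      by (rule mult_right_mono) simp
    moreover have "(?T powr s1 * ?X powr s2 * norm (g \<tau> \<xi>)) * (?T powr (- s1) * ?X powr (- s2)) = norm (g \<tau> \<xi>)"
    proof -
      have "w powr s * w powr (- s) = 1" if "0 < w" for w s :: real
        using that by (simp flip: powr_add)
      then have "(?T powr s1 * ?T powr (- s1)) * (?X powr s2 * ?X powr (- s2)) * norm (g \<tau> \<xi>) = norm (g \<tau> \<xi>)"
        by (simp only: jbracket_pos mult_1)
      then show ?thesis by (simp only: mult_ac)
    qed
    moreover have "sqrt S * (?T powr (- s1) * ?X powr (- s2)) \<le> sqrt S * torus_weight (\<tau>, \<xi>) ^ M"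
      unfolding torus_weight_def power_mult_distrib fst_conv snd_conv
      by (intro mult_left_mono mult_mono jbracket_powr_le M S real_sqrt_ge_zero powr_ge_zero zero_le_power) auto
    ultimately show ?thesis by (simp only:)
  qed
  then show thesis by (rule that)
qed

text \<open>Off the origin the extra weights are absorbed by the symbol, which turns
  \<open>g\<close> into \<open>h\<close>; the constant is squared because the terms are. At the
  origin the symbol vanishes and \<open>g0\<close> takes over.\<close>

lemma mix_term_multiplier:
  assumes est: "\<And>\<tau> \<xi>. (\<tau>, \<xi>) \<noteq> (0, 0) \<Longrightarrow>
      jbracket (of_int \<tau>) powr s1 * jbracket (of_int \<xi>) powr s2 \<le> C * norm (of_int \<tau> - c * of_int \<xi>)"
    and sol: "\<And>\<tau> \<xi>. norm (g \<tau> \<xi>) * norm (of_int \<tau> - c * of_int \<xi>) = norm (h \<tau> \<xi>)"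
    and g0: "g 0 0 = 0"
    and h: "mix_term k1 k2 h summable_on UNIV"
  shows "mix_term (k1 + s1) (k2 + s2) g summable_on UNIV"
proof (rule summable_on_comparison_test)
  show "(\<lambda>k. C\<^sup>2 * mix_term k1 k2 h k) summable_on UNIV"
    by (intro summable_on_cmult_right h)
  fix k :: "int \<times> int"
  obtain \<tau> \<xi> where k: "k = (\<tau>, \<xi>)" by (cases k)
  let ?T = "jbracket (of_int \<tau>)" and ?X = "jbracket (of_int \<xi>)"
  show "0 \<le> mix_term (k1 + s1) (k2 + s2) g k"
    by (simp add: k mix_term_eq_square)
  show "mix_term (k1 + s1) (k2 + s2) g k \<le> C\<^sup>2 * mix_term k1 k2 h k"
  proof (cases "(\<tau>, \<xi>) = (0, 0)")
    case True
    then show ?thesis by (simp add: k mix_term_eq_square g0)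
  next
    case False
    have "?T powr (k1 + s1) * ?X powr (k2 + s2) * norm (g \<tau> \<xi>)
        = (?T powr s1 * ?X powr s2) * (?T powr k1 * ?X powr k2 * norm (g \<tau> \<xi>))"
      by (simp add: powr_add)
    also have "\<dots> \<le> (C * norm (of_int \<tau> - c * of_int \<xi>)) * (?T powr k1 * ?X powr k2 * norm (g \<tau> \<xi>))"
      by (intro mult_right_mono est False) simp
    also have "\<dots> = C * (?T powr k1 * ?X powr k2 * norm (h \<tau> \<xi>))"
      unfolding sol[symmetric] by simp
    finally show ?thesis
      unfolding k mix_term_eq_square power_mult_distrib[symmetric]
      by (intro power_mono) auto
  qed
qed

text \<open>Brackets are positive, so the estimate makes the symbol nonzero off the origin. Every
  coefficient of a solution except the one at the origin is thus forced by \<open>f\<close>, and the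
  normalisation fixes the last one.\<close>

theorem L_op_solvable:
  assumes f: "f \<in> H_mix k1 k2" and f0: "fourier_coeff f 0 0 = 0"
    and est: "\<And>\<tau> \<xi>. (\<tau>, \<xi>) \<noteq> (0, 0) \<Longrightarrow>
      jbracket (of_int \<tau>) powr s1 * jbracket (of_int \<xi>) powr s2 \<le> C * norm (of_int \<tau> - c * of_int \<xi>)"
  shows "\<exists>!u. u \<in> distributions \<and> L_op c u = f \<and> fourier_coeff u 0 0 = 0"
    and "u \<in> distributions \<Longrightarrow> L_op c u = f \<Longrightarrow> fourier_coeff u 0 0 = 0 \<Longrightarrow> u \<in> H_mix (k1 + s1) (k2 + s2)"
proof -
  have fd: "f \<in> distributions" and fs: "mix_term k1 k2 (fourier_coeff f) summable_on UNIV"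
    using f by (simp_all add: H_mix_iff)
  define d where "d k = \<i> * (c * of_int (snd k) - of_int (fst k))" for k :: "int \<times> int"
  have norm_d: "norm (d (- \<tau>, - \<xi>)) = norm (of_int \<tau> - c * of_int \<xi>)" for \<tau> \<xi>
    by (simp add: d_def norm_mult)
  have d_nz: "d k \<noteq> 0" if "k \<noteq> 0" for k
  proof
    assume "d k = 0"
    obtain \<tau> \<xi> where k: "k = (- \<tau>, - \<xi>)" by (metis minus_minus surj_pair)
    have "0 < jbracket (of_int \<tau>) powr s1 * jbracket (of_int \<xi>) powr s2"
      using jbracket_pos[of "of_int \<tau>"] jbracket_pos[of "of_int \<xi>"] by simp
    also have "\<dots> \<le> C * norm (d k)"
      using that est[of \<tau> \<xi>] by (simp add: k norm_d zero_prod_def)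
    finally show False using \<open>d k = 0\<close> by simp
  qed
  have eq_iff: "L_op c u = f \<longleftrightarrow> (\<forall>k. d k * u (torus_char k) = f (torus_char k))"
    if "u \<in> distributions" for u
    unfolding d_def by (rule L_op_eq_iff[OF that fd])
  have zero_iff: "fourier_coeff v 0 0 = 0 \<longleftrightarrow> v (torus_char 0) = 0" for v
    by (simp add: fourier_coeff_torus_char zero_prod_def)
  show mem: "u \<in> H_mix (k1 + s1) (k2 + s2)"
    if u: "u \<in> distributions" "L_op c u = f" "fourier_coeff u 0 0 = 0" for u
  proof -
    have "norm (fourier_coeff u \<tau> \<xi>) * norm (of_int \<tau> - c * of_int \<xi>) = norm (fourier_coeff f \<tau> \<xi>)" for \<tau> \<xi>
      using u(2)[unfolded eq_iff[OF u(1)], rule_format, of "(- \<tau>, - \<xi>)", symmetric]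
      by (simp add: fourier_coeff_torus_char norm_divide norm_mult norm_d)
    from mix_term_multiplier[where g = "fourier_coeff u", OF est this u(3) fs] u(1) show ?thesis
      by (simp add: H_mix_iff)
  qed
  \<comment> \<open>\<open>U 0 = 0\<close> because \<open>x / 0 = 0\<close>\<close>
  define U where "U k = f (torus_char k) / d k" for k
  define g where "g \<tau> \<xi> = U (- \<tau>, - \<xi>)" for \<tau> \<xi>
  have U0: "U 0 = 0" using f0 by (simp add: U_def zero_iff)
  have dU: "d k * U k = f (torus_char k)" for k
    using d_nz[of k] f0 by (cases "k = 0") (simp_all add: U_def zero_iff)
  \<comment> \<open>The regularity estimate is applied to the candidate coefficients first, since it
    supplies the polynomial growth from which the distribution is built. Values on characters are
    not normalised, whence the factor (2 * pi)^2.\<close>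
  have "mix_term (k1 + s1) (k2 + s2) g summable_on UNIV"
  proof (rule mix_term_multiplier[OF est])
    show "norm (g \<tau> \<xi>) * norm (of_int \<tau> - c * of_int \<xi>) = norm (of_real ((2 * pi)\<^sup>2) * fourier_coeff f \<tau> \<xi>)" for \<tau> \<xi>
      using dU[of "(- \<tau>, - \<xi>)", symmetric]
      by (simp add: fourier_coeff_torus_char norm_mult g_def norm_d[symmetric] mult.commute)
    show "g 0 0 = 0" using U0 by (simp add: g_def zero_prod_def)
    have "mix_term k1 k2 (\<lambda>\<tau> \<xi>. of_real ((2 * pi)\<^sup>2) * fourier_coeff f \<tau> \<xi>)
        = (\<lambda>k. ((2 * pi)\<^sup>2)\<^sup>2 * mix_term k1 k2 (fourier_coeff f) k)"
      by (auto simp: mix_term_def norm_mult power_mult_distrib norm_power)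
    then show "mix_term k1 k2 (\<lambda>\<tau> \<xi>. of_real ((2 * pi)\<^sup>2) * fourier_coeff f \<tau> \<xi>) summable_on UNIV"
      by (simp only:) (intro summable_on_cmult_right fs)
  qed
  then obtain B M where "\<And>\<tau> \<xi>. norm (g \<tau> \<xi>) \<le> B * torus_weight (\<tau>, \<xi>) ^ M"
    by (rule mix_term_summable_imp_poly_bound) blast
  from this[of "- fst k" "- snd k" for k] have "norm (U k) \<le> B * torus_weight k ^ M" for k
    by (simp add: g_def torus_weight_def)
  then obtain u where u: "u \<in> distributions" "\<And>k. u (torus_char k) = U k"
    by (rule distribution_of_coefficients) blast
  show "\<exists>!u. u \<in> distributions \<and> L_op c u = f \<and> fourier_coeff u 0 0 = 0"
  proof
    show "u \<in> distributions \<and> L_op c u = f \<and> fourier_coeff u 0 0 = 0"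
      using u dU U0 by (simp add: eq_iff zero_iff)
    fix v
    assume "v \<in> distributions \<and> L_op c v = f \<and> fourier_coeff v 0 0 = 0"
    then have v: "v \<in> distributions" "\<And>k. d k * v (torus_char k) = f (torus_char k)" "v (torus_char 0) = 0"
      using eq_iff zero_iff by auto
    show "v = u"
    proof (rule distributions_eqI)
      show "v (torus_char k) = u (torus_char k)" for k
      proof (cases "k = 0")
        case True
        then show ?thesis using v(3) u(2) U0 by simp
      next
        case False
        have "d k * v (torus_char k) = d k * u (torus_char k)" by (simp only: v(2) u(2) dU)
        then show ?thesis using d_nz[OF False] by simp
      qed
    qed (fact v(1) u(1))+
  qed
qed

section \<open>Lower bounds for the symbol\<close>

text \<open>The imaginary part of the symbol controls \<xi>, as \<open>b\<close> is nonzero, and the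
  real part then controls \<tau>.\<close>

lemma elliptic_estimate:
  fixes a b \<theta> :: real
  assumes b: "b \<noteq> 0" and \<theta>: "\<theta> \<in> {0..1}" and nz: "(\<tau>, \<xi>) \<noteq> (0 :: int, 0 :: int)"
  shows "jbracket (of_int \<tau>) powr \<theta> * jbracket (of_int \<xi>) powr (1 - \<theta>)
    \<le> 2 * (1 + (1 + \<bar>a\<bar>) / \<bar>b\<bar>) * norm (of_int \<tau> - Complex a b * of_int \<xi>)"
proof -
  define N where "N = norm (of_int \<tau> - Complex a b * of_int \<xi>)"
  define K where "K = 1 + (1 + \<bar>a\<bar>) / \<bar>b\<bar>"
  have "\<bar>b\<bar> * \<bar>of_int \<xi>\<bar> \<le> N"
    using abs_Im_le_cmod[of "of_int \<tau> - Complex a b * of_int \<xi>"] by (simp add: N_def abs_mult)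
  then have \<xi>N: "\<bar>of_int \<xi>\<bar> \<le> N / \<bar>b\<bar>"
    using b by (simp add: pos_le_divide_eq mult.commute)
  have "\<bar>of_int \<tau> - a * of_int \<xi>\<bar> \<le> N"
    using abs_Re_le_cmod[of "of_int \<tau> - Complex a b * of_int \<xi>"] by (simp add: N_def)
  then have "\<bar>of_int \<tau>\<bar> \<le> N + \<bar>a\<bar> * \<bar>of_int \<xi>\<bar>"
    by (simp add: abs_mult[symmetric])
  also have "\<dots> \<le> N + \<bar>a\<bar> * (N / \<bar>b\<bar>)"
    by (intro add_left_mono mult_left_mono \<xi>N) auto
  finally have \<tau>N: "\<bar>of_int \<tau>\<bar> \<le> N + \<bar>a\<bar> * (N / \<bar>b\<bar>)" .
  have "N \<ge> 0" by (simp add: N_def)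
  have KN: "K * N = N + N / \<bar>b\<bar> + \<bar>a\<bar> * (N / \<bar>b\<bar>)"
    by (simp add: K_def algebra_simps add_divide_distrib)
  have \<tau>K: "\<bar>of_int \<tau>\<bar> \<le> K * N" and \<xi>K: "\<bar>of_int \<xi>\<bar> \<le> K * N"
    using \<tau>N \<xi>N \<open>N \<ge> 0\<close> by (auto simp: KN intro: add_increasing2 order_trans)
  \<comment> \<open>A nonzero integer frequency gives \<open>1 \<le> K * N\<close>, which absorbs
    the 1 in the bracket bound at the cost of the factor 2.\<close>
  have "1 \<le> \<bar>real_of_int \<tau>\<bar> \<or> 1 \<le> \<bar>real_of_int \<xi>\<bar>"
    using nz by auto
  then have "1 \<le> K * N" using \<tau>K \<xi>K by linarith
  then have "jbracket (of_int \<tau>) \<le> 2 * (K * N)" "jbracket (of_int \<xi>) \<le> 2 * (K * N)"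
    using jbracket_le_1_plus_abs[of "of_int \<tau>"] jbracket_le_1_plus_abs[of "of_int \<xi>"] \<tau>K \<xi>K by linarith+
  then have "jbracket (of_int \<tau>) powr \<theta> * jbracket (of_int \<xi>) powr (1 - \<theta>)
      \<le> (2 * (K * N)) powr \<theta> * (2 * (K * N)) powr (1 - \<theta>)"
    using \<theta> less_imp_le[OF jbracket_pos] by (intro mult_mono powr_mono2) auto
  also have "\<dots> = 2 * (K * N)"
    using \<open>1 \<le> K * N\<close> by (simp flip: powr_add)
  finally show ?thesis by (simp only: N_def K_def mult.assoc)
qed

section \<open>Irrationality measure and small denominators\<close>

text \<open>Rounding \<open>a * q\<close> gives, for each denominator, a fraction within 1 / (2 * q)
  of \<open>a\<close>. The consequence \<open>1 < r\<close> makes the exponent \<open>1 - r\<close>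
  negative in the later estimates.\<close>

lemma irrationality_measure_ge_1: "1 \<le> irrationality_measure a"
proof -
  let ?S = "{(p :: int, q :: nat). q > 0 \<and> \<bar>a - of_int p / of_nat q\<bar> < of_nat q powr (- 1)}"
  have "inj_on (\<lambda>q :: nat. (round (a * of_nat q), q)) {0<..}"
    by (auto intro: inj_onI)
  then have "infinite ((\<lambda>q :: nat. (round (a * of_nat q), q)) ` {0<..})"
    using infinite_Ioi[of "0 :: nat"] finite_imageD by blast
  moreover have "(\<lambda>q :: nat. (round (a * of_nat q), q)) ` {0<..} \<subseteq> ?S"
  proof (rule image_subsetI)
    fix q :: nat assume "q \<in> {0<..}"
    then have q: "0 < q" by simp
    have "a * of_nat q - of_int (round (a * of_nat q)) = (a - of_int (round (a * of_nat q)) / of_nat q) * of_nat q"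
      using q by (simp add: left_diff_distrib)
    then have "\<bar>a - of_int (round (a * of_nat q)) / of_nat q\<bar> = \<bar>a * of_nat q - of_int (round (a * of_nat q))\<bar> / of_nat q"
      using q by (simp add: abs_mult)
    also have "\<dots> \<le> (1 / 2) / of_nat q"
      using of_int_round_abs_le[of "a * of_nat q"] by (intro divide_right_mono) (auto simp: abs_minus_commute)
    also have "\<dots> < of_nat q powr (- 1)"
      using q by (simp add: powr_minus_divide field_simps)
    finally show "(round (a * of_nat q), q) \<in> ?S"
      using q by (simp only: mem_Collect_eq prod.case)
  qed
  ultimately have "infinite ?S" using finite_subset by blast
  then have "ereal 1 \<le> irrationality_measure a"
    unfolding irrationality_measure_def by (intro Sup_upper imageI) simp
  then show ?thesis by (simp add: one_ereal_def)
qed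

lemma irrationality_measure_less_imp_gt_1:
  assumes "irrationality_measure a < ereal r"
  shows "1 < r"
  using order.strict_trans1[OF irrationality_measure_ge_1 assms] by (simp add: one_ereal_def)

text \<open>For \<open>r\<close> above the irrationality measure only finitely many fractions
  violate the bound of order q^(-r). Irrationality keeps the finitely many exceptional values of the
  symbol away from zero.\<close>

lemma diophantine_lower_bound:
  assumes irr: "a \<notin> \<rat>" and r: "irrationality_measure a < ereal r"
  obtains c0 where "c0 > 0" "\<And>\<tau> \<xi> :: int. (\<tau>, \<xi>) \<noteq> (0, 0) \<Longrightarrow>
    c0 * jbracket (of_int \<xi>) powr (1 - r) \<le> \<bar>of_int \<tau> - a * of_int \<xi>\<bar>"
proof -
  have r1: "r > 1" by (rule irrationality_measure_less_imp_gt_1[OF r])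
  define S where "S = {(p :: int, q :: nat). q > 0 \<and> \<bar>a - of_int p / of_nat q\<bar> < of_nat q powr (- r)}"
  have fin: "finite S"
  proof (rule ccontr)
    assume "infinite S"
    then have "ereal r \<le> irrationality_measure a"
      unfolding irrationality_measure_def S_def using r1 by (intro Sup_upper imageI) simp
    with r show False by simp
  qed
  \<comment> \<open>Inserting 1 keeps the minimum defined when \<open>S\<close> is empty and gives
    \<open>c0 \<le> 1\<close>, which serves the remaining frequencies.\<close>
  define c0 where "c0 = Min (insert 1 ((\<lambda>(p, q). \<bar>of_int p - a * of_nat q\<bar>) ` S))"
  have irr': "of_int p - a * of_nat q \<noteq> 0" if "q > 0" for p :: int and q :: nat
  proof
    assume "of_int p - a * of_nat q = 0"
    then have "a = of_int p / of_nat q" using that by (simp add: field_simps)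
    with irr show False by simp
  qed
  have "c0 > 0"
    unfolding c0_def using fin irr' by (subst Min_gr_iff) (auto simp: S_def)
  have c0_le: "c0 \<le> 1" "\<And>p q. (p, q) \<in> S \<Longrightarrow> c0 \<le> \<bar>of_int p - a * of_nat q\<bar>"
    unfolding c0_def using fin by (auto intro!: Min_le)
  have X: "jbracket w powr (1 - r) \<le> 1" for w
    using powr_mono[of "1 - r" 0 "jbracket w"] jbracket_ge_1[of w] jbracket_pos[of w] r1 by simp
  have pos: "c0 * jbracket (of_nat q) powr (1 - r) \<le> \<bar>of_int p - a * of_nat q\<bar>" if q: "q > 0"
    for p :: int and q :: nat
  proof (cases "(p, q) \<in> S")
    case True
    have "c0 * jbracket (of_nat q) powr (1 - r) \<le> c0 * 1"
      using \<open>c0 > 0\<close> X by (intro mult_left_mono) auto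
    with c0_le(2)[OF True] show ?thesis by simp
  next
    case False
    have "c0 * jbracket (of_nat q) powr (1 - r) \<le> 1 * of_nat q powr (1 - r)"
      using c0_le(1) \<open>c0 > 0\<close> r1 q abs_le_jbracket[of "of_nat q"]
      by (intro mult_mono powr_mono2') auto
    also have "\<dots> = of_nat q * of_nat q powr (- r)"
      using q by (simp add: powr_diff powr_minus_divide)
    also have "\<dots> \<le> of_nat q * \<bar>a - of_int p / of_nat q\<bar>"
      using False q by (intro mult_left_mono) (auto simp: S_def)
    also have "\<dots> = \<bar>of_nat q * (a - of_int p / of_nat q)\<bar>"
      by (simp add: abs_mult)
    also have "\<dots> = \<bar>of_int p - a * of_nat q\<bar>"
      using q by (simp add: right_diff_distrib abs_minus_commute mult.commute)
    finally show ?thesis .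
  qed
  have "c0 * jbracket (of_int \<xi>) powr (1 - r) \<le> \<bar>of_int \<tau> - a * of_int \<xi>\<bar>"
    if nz: "(\<tau>, \<xi>) \<noteq> (0, 0)" for \<tau> \<xi> :: int
  proof -
    consider "\<xi> > 0" | "\<xi> < 0" | "\<xi> = 0" by linarith
    then show ?thesis
    proof cases
      case 1
      then show ?thesis using pos[of "nat \<xi>" \<tau>] by simp
    next
      case 2
      then have "c0 * jbracket (- of_int \<xi>) powr (1 - r) \<le> \<bar>- (of_int \<tau> - a * of_int \<xi>)\<bar>"
        using pos[of "nat (- \<xi>)" "- \<tau>"] by simp
      then show ?thesis by (simp only: jbracket_minus abs_minus_cancel)
    next
      case 3
      with nz have "1 \<le> \<bar>real_of_int \<tau>\<bar>" by auto
      moreover have "c0 * jbracket (of_int \<xi>) powr (1 - r) \<le> 1 * 1"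
        using \<open>c0 > 0\<close> c0_le(1) X by (intro mult_mono) auto
      ultimately show ?thesis using 3 by simp
    qed
  qed
  then show thesis using that \<open>c0 > 0\<close> by blast
qed

text \<open>For negative \<theta> the reverse comparison is the relevant one, so both are assumed
  and |\<theta>| appears as the exponent of \<open>D\<close>.\<close>

lemma powr_ratio_le:
  fixes T X D \<theta> :: real
  assumes "0 < T" "0 < X" "T \<le> D * X" "X \<le> D * T" "1 \<le> D"
  shows "T powr \<theta> \<le> D powr \<bar>\<theta>\<bar> * X powr \<theta>"
proof (cases "\<theta> \<ge> 0")
  case True
  have "T powr \<theta> \<le> (D * X) powr \<theta>" using assms True by (intro powr_mono2) auto
  then show ?thesis using assms True by (simp add: powr_mult)
next
  case False
  have "(D * T) powr \<theta> \<le> X powr \<theta>" using assms False by (intro powr_mono2') auto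
  then have "D powr (- \<theta>) * (D powr \<theta> * T powr \<theta>) \<le> D powr (- \<theta>) * X powr \<theta>"
    using assms by (intro mult_left_mono) (auto simp: powr_mult)
  moreover have "D powr (- \<theta>) * (D powr \<theta> * T powr \<theta>) = T powr \<theta>"
    using assms by (simp add: mult.assoc[symmetric] flip: powr_add)
  ultimately show ?thesis using False by simp
qed

text \<open>The brackets are comparable up to \<open>D * max 1 N\<close>, where \<open>N\<close> is
  the modulus of the symbol. Small \<open>N\<close> calls for the Diophantine bound; for large
  \<open>N\<close> the range of \<theta> ensures that at most one power of \<open>D * N\<close> is
  spent.\<close>

lemma diophantine_estimate:
  fixes a r \<theta> :: real
  assumes irr: "a \<notin> \<rat>" and r: "irrationality_measure a < ereal r" and \<theta>: "\<theta> \<in> {-r..1}"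
  obtains C where "\<And>\<tau> \<xi> :: int. (\<tau>, \<xi>) \<noteq> (0, 0) \<Longrightarrow>
    jbracket (of_int \<tau>) powr \<theta> * jbracket (of_int \<xi>) powr (1 - r - \<theta>) \<le> C * \<bar>of_int \<tau> - a * of_int \<xi>\<bar>"
proof -
  have r1: "r > 1" by (rule irrationality_measure_less_imp_gt_1[OF r])
  have a0: "a \<noteq> 0" using irr by auto
  obtain c0 where c0: "c0 > 0" and low: "\<And>\<tau> \<xi> :: int. (\<tau>, \<xi>) \<noteq> (0, 0) \<Longrightarrow>
    c0 * jbracket (of_int \<xi>) powr (1 - r) \<le> \<bar>of_int \<tau> - a * of_int \<xi>\<bar>"
    using diophantine_lower_bound[OF irr r] by blast
  \<comment> \<open>Large enough for both comparisons: 2 + |a| arises when \<tau> is bounded through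
    \<xi>, and 1 + 2 / |a| in the converse direction.\<close>
  define D where "D = 2 + \<bar>a\<bar> + 2 / \<bar>a\<bar>"
  have D: "2 + \<bar>a\<bar> \<le> D" "1 + 2 / \<bar>a\<bar> \<le> D" "1 \<le> D"
    by (simp_all add: D_def add_increasing2)
  \<comment> \<open>The first summand serves the case \<open>N \<ge> 1\<close>, the second the case
    of small \<open>N\<close>.\<close>
  define C where "C = D + D powr \<bar>\<theta>\<bar> / c0"
  have "jbracket (of_int \<tau>) powr \<theta> * jbracket (of_int \<xi>) powr (1 - r - \<theta>) \<le> C * \<bar>of_int \<tau> - a * of_int \<xi>\<bar>"
    if nz: "(\<tau>, \<xi>) \<noteq> (0, 0)" for \<tau> \<xi> :: int
  proof -
    define T where "T = jbracket (of_int \<tau>)"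
    define X where "X = jbracket (of_int \<xi>)"
    define N where "N = \<bar>of_int \<tau> - a * of_int \<xi>\<bar>"
    define M where "M = max 1 N"
    have TX: "1 \<le> T" "1 \<le> X" by (simp_all add: T_def X_def jbracket_ge_1)
    have M: "1 \<le> M" "N \<le> M" by (simp_all add: M_def)
    have N0: "0 \<le> N" by (simp add: N_def)
    have MX: "1 \<le> M * X" "M \<le> M * X" "X \<le> M * X" and MT: "1 \<le> M * T" "M \<le> M * T" "T \<le> M * T"
      using mult_mono[of 1 M 1 X] mult_mono[of M M 1 X] mult_mono[of 1 M X X]
        mult_mono[of 1 M 1 T] mult_mono[of M M 1 T] mult_mono[of 1 M T T] M TX by auto
    have TD: "T \<le> D * (M * X)"
    proof -
      have "T \<le> 1 + \<bar>of_int \<tau>\<bar>" unfolding T_def by (rule jbracket_le_1_plus_abs)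
      also have "\<bar>of_int \<tau>\<bar> \<le> N + \<bar>a * of_int \<xi>\<bar>" unfolding N_def by linarith
      also have "\<bar>a * of_int \<xi>\<bar> \<le> \<bar>a\<bar> * X"
        unfolding abs_mult X_def by (intro mult_left_mono abs_le_jbracket) auto
      also have "1 + (N + \<bar>a\<bar> * X) \<le> M * X + (M * X + \<bar>a\<bar> * (M * X))"
        by (intro add_mono mult_left_mono MX order_trans[OF M(2) MX(2)]) simp
      also have "\<dots> = (2 + \<bar>a\<bar>) * (M * X)" by (simp add: algebra_simps)
      also have "\<dots> \<le> D * (M * X)" using D MX by (intro mult_right_mono) auto
      finally show ?thesis by simp
    qed
    have XD: "X \<le> D * (M * T)"
    proof -
      have "X \<le> 1 + \<bar>of_int \<xi>\<bar>" unfolding X_def by (rule jbracket_le_1_plus_abs)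
      also have "\<bar>of_int \<xi>\<bar> = \<bar>a * of_int \<xi>\<bar> / \<bar>a\<bar>" using a0 by (simp add: abs_mult)
      also have "\<bar>a * of_int \<xi>\<bar> \<le> N + \<bar>of_int \<tau>\<bar>" unfolding N_def by linarith
      also have "\<bar>real_of_int \<tau>\<bar> \<le> T" unfolding T_def by (rule abs_le_jbracket)
      also have "1 + (N + T) / \<bar>a\<bar> \<le> M * T + (M * T + M * T) / \<bar>a\<bar>"
        by (intro add_mono divide_right_mono MT order_trans[OF M(2) MT(2)]) simp
      also have "\<dots> = (1 + 2 / \<bar>a\<bar>) * (M * T)" by (simp add: algebra_simps add_divide_distrib)
      also have "\<dots> \<le> D * (M * T)" using D MT by (intro mult_right_mono) auto
      finally show ?thesis by (simp add: divide_right_mono)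
    qed
    have Xr: "X powr (1 - r) \<le> 1" "T powr (1 - r) \<le> 1"
      using powr_mono[of "1 - r" 0 X] powr_mono[of "1 - r" 0 T] TX r1 by simp_all
    have "T powr \<theta> * X powr (1 - r - \<theta>) \<le> C * N"
    proof (cases "N \<ge> 1")
      case False
      then have M1: "M = 1" by (simp add: M_def)
      \<comment> \<open>With \<open>M = 1\<close> the brackets are comparable by \<open>D\<close>
        alone, so \<theta> moves from \<open>T\<close> to \<open>X\<close> and cancels, leaving the
        power in the Diophantine bound.\<close>
      have "T powr \<theta> * X powr (1 - r - \<theta>) \<le> (D powr \<bar>\<theta>\<bar> * X powr \<theta>) * X powr (1 - r - \<theta>)"
        using TD XD D TX M1 by (intro mult_right_mono powr_ratio_le) auto
      also have "\<dots> = D powr \<bar>\<theta>\<bar> * X powr (1 - r)"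
        by (simp add: mult.assoc flip: powr_add)
      also have "\<dots> \<le> D powr \<bar>\<theta>\<bar> * (N / c0)"
        using low[OF nz] c0 by (intro mult_left_mono) (auto simp: X_def N_def field_simps)
      also have "\<dots> \<le> C * N"
        using N0 D by (simp add: C_def algebra_simps)
      finally show ?thesis .
    next
      case True
      then have MN: "M = N" by (simp add: M_def)
      have DN: "1 \<le> D * N" using mult_mono[of 1 D 1 N] D True by simp
      have "T powr \<theta> * X powr (1 - r - \<theta>) \<le> D * N"
      proof (cases "\<theta> \<ge> 0")
        case \<theta>0: True
        have "T powr \<theta> \<le> (D * N * X) powr \<theta>"
          using TD TX \<theta>0 MN by (intro powr_mono2) (auto simp: mult.assoc)
        also have "\<dots> = (D * N) powr \<theta> * X powr \<theta>"
          using D True TX by (simp add: powr_mult)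
        \<comment> \<open>The upper endpoint \<theta> \<le> 1 limits the cost to one power of
          \<open>D * N\<close>.\<close>
        also have "(D * N) powr \<theta> \<le> (D * N) powr 1"
          using DN \<theta> by (intro powr_mono) auto
        finally have "T powr \<theta> \<le> (D * N) * X powr \<theta>"
          using DN TX by (simp add: mult_right_mono)
        then have "T powr \<theta> * X powr (1 - r - \<theta>) \<le> (D * N) * X powr \<theta> * X powr (1 - r - \<theta>)"
          by (rule mult_right_mono) simp
        also have "\<dots> = (D * N) * X powr (1 - r)"
          by (simp add: mult.assoc flip: powr_add)
        also have "\<dots> \<le> (D * N) * 1"
          using DN Xr by (intro mult_left_mono) auto
        finally show ?thesis by simp
      next
        case \<theta>0: False
        show ?thesis
        proof (cases "1 - r - \<theta> \<ge> 0")
          case True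
          have "X powr (1 - r - \<theta>) \<le> (D * N * T) powr (1 - r - \<theta>)"
            using XD TX True MN by (intro powr_mono2) (auto simp: mult.assoc)
          also have "\<dots> = (D * N) powr (1 - r - \<theta>) * T powr (1 - r - \<theta>)"
            using D \<open>N \<ge> 1\<close> TX by (simp add: powr_mult)
          \<comment> \<open>The lower endpoint enters here: \<theta> \<ge> -r means 1 - r - \<theta>
            \<le> 1.\<close>
          also have "\<dots> \<le> (D * N) powr 1 * T powr (1 - r - \<theta>)"
            using DN \<theta> by (intro mult_right_mono powr_mono) auto
          finally have "X powr (1 - r - \<theta>) \<le> (D * N) * T powr (1 - r - \<theta>)"
            using DN by simp
          then have "T powr \<theta> * X powr (1 - r - \<theta>) \<le> T powr \<theta> * ((D * N) * T powr (1 - r - \<theta>))"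
            by (rule mult_left_mono) simp
          also have "\<dots> = (D * N) * (T powr \<theta> * T powr (1 - r - \<theta>))"
            by (simp only: mult_ac)
          also have "\<dots> = (D * N) * T powr (1 - r)"
            by (simp flip: powr_add)
          also have "\<dots> \<le> (D * N) * 1"
            using DN Xr by (intro mult_left_mono) auto
          finally show ?thesis by simp
        next
          case False
          \<comment> \<open>Both exponents are negative here, so no comparison of the brackets is
            required.\<close>
          have "T powr \<theta> \<le> 1" "X powr (1 - r - \<theta>) \<le> 1"
            using powr_mono[of \<theta> 0 T] powr_mono[of "1 - r - \<theta>" 0 X] TX \<theta>0 False by simp_all
          then have "T powr \<theta> * X powr (1 - r - \<theta>) \<le> 1 * 1"
            by (intro mult_mono) auto
          with DN show ?thesis by simp
        qed
      qed
      also have "\<dots> \<le> C * N"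
        using N0 c0 by (intro mult_right_mono) (auto simp: C_def)
      finally show ?thesis .
    qed
    then show ?thesis by (simp add: T_def X_def N_def)
  qed
  then show thesis by (rule that)
qed

section \<open>Solvability and regularity in the elliptic and Diophantine cases\<close>

theorem corollary4p3:
  fixes a b k1 k2 :: real and c :: complex
    and f :: "(real \<times> real \<Rightarrow> complex) \<Rightarrow> complex"
  assumes c: "c = Complex a b"
    and f: "f \<in> H_mix k1 k2"
    and f0: "fourier_coeff f 0 0 = 0"
  shows "(b \<noteq> 0 \<longrightarrow>
      (\<exists>!u. u \<in> distributions \<and> L_op c u = f \<and> fourier_coeff u 0 0 = 0) \<and>
      (\<forall>u. u \<in> distributions \<and> L_op c u = f \<and> fourier_coeff u 0 0 = 0 \<longrightarrow>
        (\<forall>\<theta>\<in>{0..1}. u \<in> H_mix (k1 + \<theta>) (k2 + 1 - \<theta>)))) \<and>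
    (b = 0 \<and> a \<notin> \<rat> \<and> irrationality_measure a < \<infinity> \<longrightarrow>
      (\<exists>!u. u \<in> distributions \<and> L_op c u = f \<and> fourier_coeff u 0 0 = 0) \<and>
      (\<forall>u. u \<in> distributions \<and> L_op c u = f \<and> fourier_coeff u 0 0 = 0 \<longrightarrow>
        (\<forall>r. ereal r > irrationality_measure a \<longrightarrow>
          (\<forall>\<theta>\<in>{-r..1}. u \<in> H_mix (k1 + \<theta>) (k2 + 1 - r - \<theta>)))))"
proof (intro conjI impI)
  assume b: "b \<noteq> 0"
  have est: "jbracket (of_int \<tau>) powr \<theta> * jbracket (of_int \<xi>) powr (1 - \<theta>)
      \<le> 2 * (1 + (1 + \<bar>a\<bar>) / \<bar>b\<bar>) * norm (of_int \<tau> - c * of_int \<xi>)"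
    if "\<theta> \<in> {0..1}" "(\<tau>, \<xi>) \<noteq> (0, 0)" for \<theta> \<tau> \<xi>
    unfolding c by (rule elliptic_estimate[OF b that])
  \<comment> \<open>A single admissible exponent, here \<theta> = 0, gives existence and uniqueness;
    the regularity part then varies \<theta> for the same solution.\<close>
  show "\<exists>!u. u \<in> distributions \<and> L_op c u = f \<and> fourier_coeff u 0 0 = 0"
    by (rule L_op_solvable(1)[OF f f0 est[of 0]]) auto
  show "\<forall>u. u \<in> distributions \<and> L_op c u = f \<and> fourier_coeff u 0 0 = 0 \<longrightarrow>
        (\<forall>\<theta>\<in>{0..1}. u \<in> H_mix (k1 + \<theta>) (k2 + 1 - \<theta>))"
    using L_op_solvable(2)[OF f f0 est] by (simp add: algebra_simps)
next
  assume "b = 0 \<and> a \<notin> \<rat> \<and> irrationality_measure a < \<infinity>"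
  then have b: "b = 0" and irr: "a \<notin> \<rat>" and fin: "irrationality_measure a < \<infinity>" by auto
  have norm: "norm (of_int \<tau> - c * of_int \<xi>) = \<bar>of_int \<tau> - a * of_int \<xi>\<bar>" for \<tau> \<xi>
  proof -
    have "of_int \<tau> - c * of_int \<xi> = of_real (of_int \<tau> - a * of_int \<xi>)"
      by (simp add: c b complex_eq_iff)
    then show ?thesis by (simp only: norm_of_real)
  qed
  have est: "\<exists>C. \<forall>\<tau> \<xi>. (\<tau>, \<xi>) \<noteq> (0, 0) \<longrightarrow>
      jbracket (of_int \<tau>) powr \<theta> * jbracket (of_int \<xi>) powr (1 - r - \<theta>) \<le> C * norm (of_int \<tau> - c * of_int \<xi>)"
    if "irrationality_measure a < ereal r" "\<theta> \<in> {-r..1}" for r \<theta>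
    unfolding norm by (rule diophantine_estimate[OF irr that]) blast
  \<comment> \<open>Finiteness of the measure provides a real \<open>r\<close> above it. With
    \<theta> = 0 this settles existence and uniqueness, and regularity is then shown for every
    admissible \<open>r\<close> and \<theta>.\<close>
  obtain r where r: "irrationality_measure a < ereal r"
    using ereal_dense2[OF fin] by blast
  have "0 \<in> {-r..1}" using irrationality_measure_less_imp_gt_1[OF r] by simp
  from est[OF r this] obtain C where "\<And>\<tau> \<xi>. (\<tau>, \<xi>) \<noteq> (0, 0) \<Longrightarrow>
      jbracket (of_int \<tau>) powr 0 * jbracket (of_int \<xi>) powr (1 - r - 0) \<le> C * norm (of_int \<tau> - c * of_int \<xi>)"
    by blast
  from L_op_solvable(1)[OF f f0 this]
  show "\<exists>!u. u \<in> distributions \<and> L_op c u = f \<and> fourier_coeff u 0 0 = 0" .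
  show "\<forall>u. u \<in> distributions \<and> L_op c u = f \<and> fourier_coeff u 0 0 = 0 \<longrightarrow>
        (\<forall>r. ereal r > irrationality_measure a \<longrightarrow>
          (\<forall>\<theta>\<in>{-r..1}. u \<in> H_mix (k1 + \<theta>) (k2 + 1 - r - \<theta>)))"
  proof (intro allI impI ballI)
    fix u r \<theta>
    assume u: "u \<in> distributions \<and> L_op c u = f \<and> fourier_coeff u 0 0 = 0"
      and "irrationality_measure a < ereal r" "\<theta> \<in> {-r..1}"
    then obtain C where "\<And>\<tau> \<xi>. (\<tau>, \<xi>) \<noteq> (0, 0) \<Longrightarrow>
      jbracket (of_int \<tau>) powr \<theta> * jbracket (of_int \<xi>) powr (1 - r - \<theta>) \<le> C * norm (of_int \<tau> - c * of_int \<xi>)"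
      using est by blast
    from L_op_solvable(2)[OF f f0 this] u have "u \<in> H_mix (k1 + \<theta>) (k2 + (1 - r - \<theta>))"
      by blast
    then show "u \<in> H_mix (k1 + \<theta>) (k2 + 1 - r - \<theta>)"
      by (simp add: algebra_simps)
  qed
qed

end
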